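(* Let $\rho=\frac{53}{25}$ and $\alpha=\frac{823}{625}=1.3168$. Let $y$ be a feasible solution of the configuration LP. Then for every machine $i\in M$ and every Smith prefix $[j^*]$ on machine $i$ with positive fractional processing volume $V=\sum_{j\in[j^*]}z_{ij}p_j$, the associated normalized quantities $Q$, $F$ and $\overline S$ (with $\overline S$ defined using class ratio $\rho$) satisfy \[ 2Q+1-\overline S\ \le\ \alpha\,(Q+F). \]
   Context: Setting. $J$ is a finite set of $n$ jobs, $M$ a finite set of machines. Each job $j$ has a machine-independent size $p_j>0$, and each feasible pair $(i,j)$ has a weight $w_{ij}>0$ (infeasible pairs are regarded as having $w_{ij}=+\infty$). For $i\in M$ let $J_i=\{j\in J:(i,j)\text{ feasible}\}$ and let $\mathcal F_i$ be the set of all subsets of $J_i$ (configurations). A feasible solution of the configuration LP is a vector $(y_{if})_{i\in M,f\in\mathcal F_i}$ with $y_{if}\ge 0$, $\sum_{f\in\mathcal F_i}y_{if}=1$ for every $i\in M$, and $\sum_{i\in M}\sum_{f\in\mathcal F_i,\,f\ni j}y_{if}=1$ for every $j\in J$. Set $z_{ij}:=\sum_{f\in\mathcal F_i,\,f\ni j}y_{if}$ if $j\in J_i$ and $z_{ij}:=0$ otherwise. For a machine $i$, fix a total order of the jobs refining nonincreasing Smith ratio $w_{ij}/p_j$, and index the jobs $1,\dots,n$ in this order; a Smith prefix is a set $[j^*]=\{1,\dots,j^*\}$ with $1\le j^*\le n$. Fixed-prefix normalization. For fixed $i$ and $[j^*]$ let $V:=\sum_{j\in[j^*]}z_{ij}p_j>0$.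 For $j\in[j^*]$ put $r_j:=p_j/V$. Define \[ Q:=\sum_{j\in[j^*]}z_{ij}r_j^2,\qquad T_f:=\sum_{j\in f\cap[j^*]}r_j\ (f\in\mathcal F_i),\qquad F:=\sum_{f\in\mathcal F_i}y_{if}T_f^2 . \] Class saving. For $\rho>1$, let $\beta\in[1,\rho)$ be random with $\ln\beta$ uniform on $[0,\ln\rho)$. For $k\in\mathbb Z$ let $\tau_k:=\beta\rho^k/V$ and \[ v_k:=\sum_{j\in[j^*]:\ \beta\rho^k\le p_j<\beta\rho^{k+1}} z_{ij}r_j . \] Define $S_\beta:=\sum_{k\in\mathbb Z}\min\{v_k,\tau_k\}^2$ and $\overline S:=\mathbb E_\beta[S_\beta]$. *)

theory Defs
  imports "HOL-Probability.Probability"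
begin

(* An instance is given by the set of jobs J, the set of machines M, the sizes p j and the
   extended-real weights w i j; the pair (i, j) is infeasible iff w i j = \<infinity>. *)

definition sched_instance ::
    "'j set \<Rightarrow> 'm set \<Rightarrow> ('j \<Rightarrow> real) \<Rightarrow> ('m \<Rightarrow> 'j \<Rightarrow> ereal) \<Rightarrow> bool" where
  "sched_instance J M p w \<longleftrightarrow>
     finite J \<and> finite M \<and> (\<forall>j\<in>J. 0 < p j) \<and> (\<forall>i\<in>M. \<forall>j\<in>J. 0 < w i j)"

definition feasible_jobs :: "'j set \<Rightarrow> ('m \<Rightarrow> 'j \<Rightarrow> ereal) \<Rightarrow> 'm \<Rightarrow> 'j set" where
  "feasible_jobs J w i = {j \<in> J. w i j \<noteq> \<infinity>}"

definition configs :: "'j set \<Rightarrow> ('m \<Rightarrow> 'j \<Rightarrow> ereal) \<Rightarrow> 'm \<Rightarrow> 'j set set" where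
  "configs J w i = Pow (feasible_jobs J w i)"

definition config_lp_feasible ::
    "'j set \<Rightarrow> 'm set \<Rightarrow> ('m \<Rightarrow> 'j \<Rightarrow> ereal) \<Rightarrow> ('m \<Rightarrow> 'j set \<Rightarrow> real) \<Rightarrow> bool" where
  "config_lp_feasible J M w y \<longleftrightarrow>
     (\<forall>i\<in>M. \<forall>f\<in>configs J w i. 0 \<le> y i f) \<and>
     (\<forall>i\<in>M. (\<Sum>f\<in>configs J w i. y i f) = 1) \<and>
     (\<forall>j\<in>J. (\<Sum>i\<in>M. \<Sum>f\<in>{f \<in> configs J w i. j \<in> f}. y i f) = 1)"

definition assigned_frac ::
    "'j set \<Rightarrow> ('m \<Rightarrow> 'j \<Rightarrow> ereal) \<Rightarrow> ('m \<Rightarrow> 'j set \<Rightarrow> real) \<Rightarrow> 'm \<Rightarrow> 'j \<Rightarrow> real" where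
  "assigned_frac J w y i j =
     (if j \<in> feasible_jobs J w i then \<Sum>f\<in>{f \<in> configs J w i. j \<in> f}. y i f else 0)"

(* \<sigma> enumerates all jobs as \<sigma> 1, ..., \<sigma> n; infeasible jobs have Smith ratio \<infinity>. *)
definition smith_order ::
    "'j set \<Rightarrow> ('j \<Rightarrow> real) \<Rightarrow> ('m \<Rightarrow> 'j \<Rightarrow> ereal) \<Rightarrow> 'm \<Rightarrow> (nat \<Rightarrow> 'j) \<Rightarrow> bool" where
  "smith_order J p w i \<sigma> \<longleftrightarrow>
     bij_betw \<sigma> {1..card J} J \<and>
     (\<forall>a\<in>{1..card J}. \<forall>b\<in>{1..card J}. a \<le> b \<longrightarrow>
        w i (\<sigma> b) / ereal (p (\<sigma> b)) \<le> w i (\<sigma> a) / ereal (p (\<sigma> a)))"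

(* In the following, P is the set of jobs of a Smith prefix on the machine considered,
   z j is the fraction of job j assigned to that machine, \<F> is its set of configurations,
   and x f is the LP value of configuration f on it. *)

definition prefix_volume :: "('j \<Rightarrow> real) \<Rightarrow> ('j \<Rightarrow> real) \<Rightarrow> 'j set \<Rightarrow> real" where
  "prefix_volume p z P = (\<Sum>j\<in>P. z j * p j)"

definition norm_size :: "('j \<Rightarrow> real) \<Rightarrow> ('j \<Rightarrow> real) \<Rightarrow> 'j set \<Rightarrow> 'j \<Rightarrow> real" where
  "norm_size p z P j = p j / prefix_volume p z P"

definition Q_val :: "('j \<Rightarrow> real) \<Rightarrow> ('j \<Rightarrow> real) \<Rightarrow> 'j set \<Rightarrow> real" where
  "Q_val p z P = (\<Sum>j\<in>P. z j * (norm_size p z P j)\<^sup>2)"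

definition T_val :: "('j \<Rightarrow> real) \<Rightarrow> ('j \<Rightarrow> real) \<Rightarrow> 'j set \<Rightarrow> 'j set \<Rightarrow> real" where
  "T_val p z P f = (\<Sum>j\<in>f \<inter> P. norm_size p z P j)"

definition F_val ::
    "('j \<Rightarrow> real) \<Rightarrow> ('j \<Rightarrow> real) \<Rightarrow> 'j set set \<Rightarrow> ('j set \<Rightarrow> real) \<Rightarrow> 'j set \<Rightarrow> real" where
  "F_val p z \<F> x P = (\<Sum>f\<in>\<F>. x f * (T_val p z P f)\<^sup>2)"

definition class_threshold ::
    "('j \<Rightarrow> real) \<Rightarrow> ('j \<Rightarrow> real) \<Rightarrow> 'j set \<Rightarrow> real \<Rightarrow> real \<Rightarrow> int \<Rightarrow> real" where
  "class_threshold p z P \<rho> \<beta> k = \<beta> * \<rho> powi k / prefix_volume p z P"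

definition class_volume ::
    "('j \<Rightarrow> real) \<Rightarrow> ('j \<Rightarrow> real) \<Rightarrow> 'j set \<Rightarrow> real \<Rightarrow> real \<Rightarrow> int \<Rightarrow> real" where
  "class_volume p z P \<rho> \<beta> k =
     (\<Sum>j\<in>{j \<in> P. \<beta> * \<rho> powi k \<le> p j \<and> p j < \<beta> * \<rho> powi (k + 1)}. z j * norm_size p z P j)"

(* Only finitely many terms are nonzero: an empty class has volume 0, and thresholds are
   positive. *)
definition class_saving ::
    "('j \<Rightarrow> real) \<Rightarrow> ('j \<Rightarrow> real) \<Rightarrow> 'j set \<Rightarrow> real \<Rightarrow> real \<Rightarrow> real" where
  "class_saving p z P \<rho> \<beta> =
     (\<Sum>\<^sub>\<infinity>k::int. (min (class_volume p z P \<rho> \<beta> k) (class_threshold p z P \<rho> \<beta> k))\<^sup>2)"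

(* The law of \<beta> when ln \<beta> is uniform on [0, ln \<rho>). *)
definition log_uniform :: "real \<Rightarrow> real measure" where
  "log_uniform \<rho> = distr (uniform_measure lborel {0..<ln \<rho>}) borel exp"

definition expected_saving :: "('j \<Rightarrow> real) \<Rightarrow> ('j \<Rightarrow> real) \<Rightarrow> 'j set \<Rightarrow> real \<Rightarrow> real" where
  "expected_saving p z P \<rho> = (\<integral>\<beta>. class_saving p z P \<rho> \<beta> \<partial>log_uniform \<rho>)"

end

theory Submission
  imports Defs
begin

text \<open>
Write \<open>L = ln \<rho>\<close>, let \<open>v(\<tau>)\<close> be the volume \<open>\<Sum> z\<^sub>j r\<^sub>j\<close> over \<open>\<tau> \<le> r\<^sub>j < \<rho>\<tau>\<close>, and unfold the
expectation over \<open>\<beta>\<close> and the sum over \<open>k\<close> into a single integral, so that \<open>L\<close> times the expected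
saving equals \<open>\<integral> min(v(\<tau>), \<tau>)\<^sup>2 d\<tau>/\<tau>\<close> over \<open>\<tau> > 0\<close>. For fixed \<open>\<beta>\<close> the classes are disjoint, so their
volumes sum to at most \<open>1\<close>; this allows linearising all capped squares simultaneously,
\<open>\<Sum> min(v\<^sub>k, \<tau>\<^sub>k)\<^sup>2 \<ge> \<Sum> (2 a\<^sub>k v\<^sub>k - a\<^sub>k\<^sup>2)\<close>, for slopes \<open>a\<^sub>k = u(\<tau>\<^sub>k) \<tau>\<^sub>k\<close> that are much larger than
those admissible class by class. With a step function \<open>u\<close>, averaging over \<open>\<beta>\<close> gives a bound which is
linear in the measure \<open>\<Sum> z\<^sub>j r\<^sub>j \<delta>(r\<^sub>j)\<close>. Likewise \<open>T\<^sub>f\<^sup>2 \<ge> 2sT\<^sub>f - s\<^sup>2 + \<Sum> max(0, r\<^sub>j - s)\<^sup>2\<close> over \<open>j \<in> f\<close>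
bounds \<open>F\<close> linearly. As this measure has total mass \<open>1\<close>, the claim reduces to a piecewise inequality
in a single size \<open>r > 0\<close>, which holds for a suitable choice of \<open>u\<close> and \<open>s = 9/10\<close>.
\<close>

subsection \<open>Linearising the capped squares\<close>

text \<open>A Lagrangian argument: the budget \<open>sum v I \<le> 1\<close> gets the multiplier
  \<open>2 * b\<close>, where \<open>b\<close> is the steepest slope of a capped class. Capped
  classes then gain nothing from their volume, and each uncapped class is handled by completing the
  square. Hypothesis \<open>cap\<close> is the inequality that remains.\<close>

lemma capped_squares_ge:
  fixes a v t :: "'a \<Rightarrow> real"
  assumes I: "finite I" and v: "\<And>k. k \<in> I \<Longrightarrow> 0 \<le> v k" "sum v I \<le> 1"
    and a: "\<And>k. k \<in> I \<Longrightarrow> 0 \<le> a k"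
    and cap: "\<And>k. k \<in> I \<Longrightarrow> 2 * a k - (t k)\<^sup>2 \<le> (\<Sum>l\<in>I. (a l)\<^sup>2 - (max 0 (a l - a k))\<^sup>2)"
  shows "(\<Sum>k\<in>I. 2 * a k * v k - (a k)\<^sup>2) \<le> (\<Sum>k\<in>I. (min (v k) (t k))\<^sup>2)"
proof -
  define K where "K = {k \<in> I. t k < v k}"
  show ?thesis
  proof (cases "K = {}")
    case True
    have "2 * a k * v k - (a k)\<^sup>2 \<le> (min (v k) (t k))\<^sup>2" if "k \<in> I" for k
    proof -
      have "min (v k) (t k) = v k" using True that by (auto simp: K_def)
      moreover have "0 \<le> (v k - a k)\<^sup>2" by simp
      ultimately show ?thesis by (simp add: power2_eq_square algebra_simps)
    qed
    thus ?thesis by (rule sum_mono)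
  next
    case False
    have fK: "finite K" using I by (simp add: K_def)
    \<comment> \<open>Moving the volume of all capped classes to the one with the steepest slope only decreases
      the difference of the two sides.\<close>
    define b where "b = Max (a ` K)"
    have "b \<in> a ` K" unfolding b_def using fK False by (intro Max_in) auto
    then obtain k where k: "k \<in> K" "a k = b" by blast
    have kI: "k \<in> I" using k by (simp add: K_def)
    have ab: "a l \<le> b" if "l \<in> K" for l
      using fK that by (simp add: b_def)
    have b0: "0 \<le> b" using a[OF kI] k by simp
    have term_le: "2 * a l * v l - (a l)\<^sup>2 + ((a l)\<^sup>2 - (max 0 (a l - b))\<^sup>2) - 2 * b * v l
        \<le> (min (v l) (t l))\<^sup>2 - (if l = k then (t k)\<^sup>2 else 0)" if l: "l \<in> I" for l
    proof (cases "l \<in> K")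
      case True
      have "a l * v l \<le> b * v l" using ab[OF True] v l by (simp add: mult_right_mono)
      moreover have "(if l = k then (t k)\<^sup>2 else 0) \<le> (min (v l) (t l))\<^sup>2"
        using True by (auto simp: K_def)
      moreover have "0 \<le> (max 0 (a l - b))\<^sup>2" by simp
      ultimately show ?thesis by linarith
    next
      case False
      hence m: "min (v l) (t l) = v l" "l \<noteq> k" using l k by (auto simp: K_def)
      have "2 * (a l - b) * v l \<le> 2 * max 0 (a l - b) * v l"
        using v(1)[OF l] by (intro mult_right_mono mult_left_mono max.cobounded2) auto
      moreover have "0 \<le> (max 0 (a l - b) - v l)\<^sup>2" by simp
      hence "2 * max 0 (a l - b) * v l \<le> (max 0 (a l - b))\<^sup>2 + (v l)\<^sup>2"
        by (simp add: power2_diff)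
      ultimately show ?thesis using m by (simp add: algebra_simps)
    qed
    have "(\<Sum>l\<in>I. 2 * a l * v l - (a l)\<^sup>2) + (\<Sum>l\<in>I. (a l)\<^sup>2 - (max 0 (a l - b))\<^sup>2) - 2 * b * sum v I
      \<le> (\<Sum>l\<in>I. (min (v l) (t l))\<^sup>2) - (\<Sum>l\<in>I. if l = k then (t k)\<^sup>2 else 0)"
      using sum_mono[of I, OF term_le] by (simp add: sum.distrib sum_subtractf sum_distrib_left)
    moreover have "(\<Sum>l\<in>I. if l = k then (t k)\<^sup>2 else 0) = (t k)\<^sup>2"
      using I kI by simp
    moreover have "b * sum v I \<le> b" using b0 v(2) by (simp add: mult_left_le)
    moreover have "2 * b - (t k)\<^sup>2 \<le> (\<Sum>l\<in>I. (a l)\<^sup>2 - (max 0 (a l - b))\<^sup>2)"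
      using cap[OF kI] k by simp
    ultimately show ?thesis by linarith
  qed
qed

subsection \<open>Averaging over the random class boundaries\<close>

lemma prob_space_log_uniform: "1 < \<rho> \<Longrightarrow> prob_space (log_uniform \<rho>)"
  unfolding log_uniform_def
  by (intro prob_space.prob_space_distr prob_space_uniform_measure) (auto simp: emeasure_lborel_Ico)

lemma space_log_uniform [simp]: "space (log_uniform \<rho>) = UNIV"
  and sets_log_uniform [simp, measurable_cong]: "sets (log_uniform \<rho>) = sets borel"
  by (simp_all add: log_uniform_def)

lemma AE_log_uniform:
  assumes "1 < \<rho>" shows "AE \<beta> in log_uniform \<rho>. \<beta> \<in> {1..<\<rho>}"
proof -
  have "AE t in uniform_measure lborel {0..<ln \<rho>}. exp t \<in> {1..<\<rho>}"
  proof (rule AE_uniform_measureI)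
    have "exp t < \<rho>" if "t < ln \<rho>" for t
      using exp_less_mono[OF that] assms by simp
    thus "AE t in lborel. t \<in> {0..<ln \<rho>} \<longrightarrow> exp t \<in> {1..<\<rho>}" by simp
  qed simp
  thus ?thesis unfolding log_uniform_def
    by (subst AE_distr_iff) auto
qed

lemma integral_log_uniform:
  fixes f :: "real \<Rightarrow> real"
  assumes [measurable]: "f \<in> borel_measurable borel" and "1 < \<rho>"
  shows "(\<integral>\<beta>. f \<beta> \<partial>log_uniform \<rho>) = (\<integral>t. indicator {0..<ln \<rho>} t * f (exp t) \<partial>lborel) / ln \<rho>"
proof -
  have L: "0 < ln \<rho>" using assms by simp
  have "(\<integral>\<beta>. f \<beta> \<partial>log_uniform \<rho>) = (\<integral>t. f (exp t) \<partial>uniform_measure lborel {0..<ln \<rho>})"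
    unfolding log_uniform_def by (subst integral_distr) auto
  also have "uniform_measure lborel {0..<ln \<rho>}
      = density lborel (\<lambda>t. ennreal (indicator {0..<ln \<rho>} t / ln \<rho>))"
    unfolding uniform_measure_def using L
    by (intro density_cong) (auto simp: divide_ennreal[symmetric] ennreal_indicator)
  also have "(\<integral>t. f (exp t) \<partial>\<dots>) = (\<integral>t. (indicator {0..<ln \<rho>} t / ln \<rho>) * f (exp t) \<partial>lborel)"
    using L by (subst integral_density) auto
  also have "\<dots> = (\<integral>t. indicator {0..<ln \<rho>} t * f (exp t) \<partial>lborel) / ln \<rho>"
    by simp
  finally show ?thesis .
qed

text \<open>The translates of the fundamental domain [0, L) tile the line. Cell number
  \<open>N\<close> ends at \<open>(N + 1) * L\<close>, which explains the asymmetric support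
  condition.\<close>

lemma integral_unfold:
  fixes g :: "real \<Rightarrow> real" and N :: int
  assumes g: "integrable lborel g" and L: "0 < L"
    and supp: "\<And>s. s \<notin> {- of_int N * L..<(of_int N + 1) * L} \<Longrightarrow> g s = 0"
  shows "(\<integral>t. indicator {0..<L} t * (\<Sum>k\<in>{-N..N}. g (t + of_int k * L)) \<partial>lborel) = (\<integral>s. g s \<partial>lborel)"
proof -
  have shift: "integrable lborel (\<lambda>s. indicator {of_int k * L..<(of_int k + 1) * L} s * g s)" for k :: int
    using integrable_mult_indicator[of "{of_int k * L..<(of_int k + 1) * L}" lborel g] g by simp
  have eq: "(\<lambda>t. indicator {of_int k * L..<(of_int k + 1) * L} (of_int k * L + 1 * t) * g (of_int k * L + 1 * t))
    = (\<lambda>t. indicator {0..<L} t * g (t + of_int k * L))" for k :: int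
    by (auto simp: fun_eq_iff indicator_def algebra_simps)
  have int: "integrable lborel (\<lambda>t. indicator {0..<L} t * g (t + of_int k * L))" for k :: int
    using lborel_integrable_real_affine[OF shift, of 1 k "of_int k * L"] by (simp only: eq)
  have val: "(\<integral>t. indicator {0..<L} t * g (t + of_int k * L) \<partial>lborel)
      = (\<integral>s. indicator {of_int k * L..<(of_int k + 1) * L} s * g s \<partial>lborel)" for k :: int
    using lborel_integral_real_affine[of 1 "\<lambda>s. indicator {of_int k * L..<(of_int k + 1) * L} s * g s" "of_int k * L"]
    by (simp only: eq) simp
  have "(\<integral>t. indicator {0..<L} t * (\<Sum>k\<in>{-N..N}. g (t + of_int k * L)) \<partial>lborel)
     = (\<Sum>k\<in>{-N..N}. \<integral>s. indicator {of_int k * L..<(of_int k + 1) * L} s * g s \<partial>lborel)"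
    unfolding sum_distrib_left using int by (subst Bochner_Integration.integral_sum) (simp_all only: val)
  also have "\<dots> = (\<integral>s. (\<Sum>k\<in>{-N..N}. indicator {of_int k * L..<(of_int k + 1) * L} s * g s) \<partial>lborel)"
    by (rule Bochner_Integration.integral_sum[symmetric]) (rule shift)
  also have "\<dots> = (\<integral>s. g s \<partial>lborel)"
  proof (intro Bochner_Integration.integral_cong refl)
    fix s :: real
    show "(\<Sum>k\<in>{-N..N}. indicator {of_int k * L..<(of_int k + 1) * L} s * g s) = g s"
    proof (cases "g s = 0")
      case False
      hence s: "- of_int N * L \<le> s" "s < (of_int N + 1) * L" using supp by force+
      \<comment> \<open>The cell containing \<open>s\<close> is given by a floor, so exactly one
        summand survives.\<close>
      have mem: "s \<in> {of_int k * L..<(of_int k + 1) * L} \<longleftrightarrow> \<lfloor>s / L\<rfloor> = k" for k :: int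
        using L by (simp add: floor_eq_iff field_simps)
      have "(\<Sum>k\<in>{-N..N}. indicator {of_int k * L..<(of_int k + 1) * L} s * g s)
          = (\<Sum>k\<in>{-N..N}. if \<lfloor>s / L\<rfloor> = k then g s else 0)"
        by (intro sum.cong refl) (simp only: mem indicator_def, simp)
      moreover have "- of_int N \<le> s / L" "s / L < of_int N + 1"
        using s L by (simp_all add: field_simps)
      hence "- N \<le> \<lfloor>s / L\<rfloor>" "\<lfloor>s / L\<rfloor> < N + 1"
        by (simp_all only: le_floor_iff floor_less_iff of_int_minus of_int_add of_int_1)
      ultimately show ?thesis by simp
    qed simp
  qed
  finally show ?thesis .
qed


text \<open>With s = ln (\<beta> \<rho>^k), averaging over \<beta> and summing over k unfold into
  one integral of (exp s / V)^m ds, that is, of x^(m-1) dx from \<open>c\<close> to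
  \<open>d\<close>, divided by ln \<rho>. The set \<open>A\<close> is fixed only up to end points
  because intervals half-open on either side occur. The conditions on \<open>N\<close> ensure that
  every threshold in \<open>A\<close> has its index in \<open>{-N..N}\<close>.\<close>

lemma
  fixes A :: "real set" and N :: int
  assumes "1 < \<rho>" "0 < V" "0 < c" "c \<le> d" "0 < m"
    and A[measurable]: "A \<in> sets borel" and A_bounds: "{c<..<d} \<subseteq> A" "A \<subseteq> {c..d}"
    and N: "\<rho> powi (- N) \<le> V * c" "V * d < \<rho> powi (N + 1)"
  defines "h \<equiv> \<lambda>\<beta>. \<Sum>k\<in>{-N..N}. indicator A (\<beta> * \<rho> powi k / V) * (\<beta> * \<rho> powi k / V) ^ m"
  shows integrable_class_moment: "integrable (log_uniform \<rho>) h"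
    and expectation_class_moment: "(\<integral>\<beta>. h \<beta> \<partial>log_uniform \<rho>) = (d ^ m - c ^ m) / (real m * ln \<rho>)"
proof -
  interpret prob_space "log_uniform \<rho>" by (rule prob_space_log_uniform) fact
  have h_meas [measurable]: "h \<in> borel_measurable borel" unfolding h_def by measurable
  have "0 \<le> indicator A x * x ^ m \<and> indicator A x * x ^ m \<le> d ^ m" for x :: real
    using A_bounds assms by (auto simp: indicator_def intro!: power_mono)
  hence "norm (h \<beta>) \<le> (\<Sum>k\<in>{-N..N}. d ^ m)" for \<beta>
    unfolding h_def by (intro order.trans[OF norm_sum] sum_mono) simp
  thus "integrable (log_uniform \<rho>) h"
    by (intro integrable_const_bound[where B = "\<Sum>k\<in>{-N..N}. d ^ m"]) auto

  define L where "L = ln \<rho>"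
  have L: "0 < L" using assms by (simp add: L_def)
  have powi: "\<rho> powi k = exp (of_int k * L)" for k
    using exp_power_int[of L k] assms by (simp add: L_def)
  define g where "g s = indicator A (exp s / V) * (exp s / V) ^ m" for s
  define a b where "a = ln (V * c)" and "b = ln (V * d)"
  have ab: "exp a = V * c" "exp b = V * d" "a \<le> b"
    using assms by (auto simp: a_def b_def)
  have F: "has_bochner_integral lborel (\<lambda>s. (exp s / V) ^ m * indicator {a..b} s)
      ((exp b / V) ^ m / m - (exp a / V) ^ m / m)"
  proof (rule has_bochner_integral_FTC_Icc_real)
    fix s
    have "((exp s / V) ^ (m - Suc 0) * (exp s / V)) = (exp s / V) ^ m"
      using \<open>0 < m\<close> by (metis One_nat_def Suc_diff_1 mult.commute power_Suc)
    thus "DERIV (\<lambda>s. (exp s / V) ^ m / m) s :> (exp s / V) ^ m"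
      using assms by (auto intro!: derivative_eq_intros simp: mult.commute)
  qed (use ab assms in \<open>auto intro!: continuous_intros\<close>)
  \<comment> \<open>Membership of the end points in \<open>A\<close> is left open, but they form a
    null set.\<close>
  have g_AE: "AE s in lborel. g s = (exp s / V) ^ m * indicator {a..b} s"
    using AE_lborel_singleton[of a] AE_lborel_singleton[of b]
  proof eventually_elim
    case (elim s)
    have "exp s / V \<in> A \<longleftrightarrow> s \<in> {a..b}"
    proof
      assume "exp s / V \<in> A"
      hence "exp a \<le> exp s" "exp s \<le> exp b"
        using A_bounds assms by (auto simp: ab field_simps)
      thus "s \<in> {a..b}" by simp
    next
      assume "s \<in> {a..b}"
      hence "exp a < exp s" "exp s < exp b" using elim by simp_all
      hence "exp s / V \<in> {c<..<d}" using assms by (simp add: ab field_simps)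
      thus "exp s / V \<in> A" using A_bounds by blast
    qed
    thus ?case by (simp add: g_def indicator_def)
  qed
  have [measurable]: "g \<in> borel_measurable borel" unfolding g_def by measurable
  have g: "has_bochner_integral lborel g ((exp b / V) ^ m / m - (exp a / V) ^ m / m)"
    using F by (rule has_bochner_integral_cong_AE[THEN iffD1, rotated 3])
      (use g_AE in \<open>auto elim!: eventually_mono\<close>)
  have "(\<integral>\<beta>. h \<beta> \<partial>log_uniform \<rho>) = (\<integral>t. indicator {0..<L} t * h (exp t) \<partial>lborel) / L"
    unfolding L_def by (rule integral_log_uniform[OF h_meas \<open>1 < \<rho>\<close>])
  also have "(\<lambda>t. h (exp t)) = (\<lambda>t. \<Sum>k\<in>{-N..N}. g (t + of_int k * L))"
    by (simp add: h_def g_def powi exp_add)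
  also have "(\<integral>t. indicator {0..<L} t * (\<Sum>k\<in>{-N..N}. g (t + of_int k * L)) \<partial>lborel) = (\<integral>s. g s \<partial>lborel)"
  proof (rule integral_unfold[OF _ L])
    show "integrable lborel g" using g by (simp add: has_bochner_integral_iff)
    fix s assume s: "s \<notin> {- of_int N * L..<(of_int N + 1) * L}"
    have "exp (- of_int N * L) \<le> exp a" "exp b < exp ((of_int N + 1) * L)"
      using N powi[of "-N"] powi[of "N + 1"] by (simp_all add: ab)
    hence "- of_int N * L \<le> a" "b < (of_int N + 1) * L" by simp_all
    hence "s < a \<or> b < s" using s by auto
    hence "exp s < exp a \<or> exp b < exp s" by simp
    hence "exp s / V < c \<or> d < exp s / V" using \<open>0 < V\<close> by (simp add: ab field_simps)
    hence "exp s / V \<notin> A" using A_bounds by auto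
    thus "g s = 0" by (simp add: g_def)
  qed
  also have "\<dots> = (d ^ m - c ^ m) / m"
    using g assms by (simp add: has_bochner_integral_iff ab diff_divide_distrib)
  finally show "(\<integral>\<beta>. h \<beta> \<partial>log_uniform \<rho>) = (d ^ m - c ^ m) / (real m * ln \<rho>)"
    by (simp add: L_def)
qed

subsection \<open>The expected saving\<close>

text \<open>Up to its end points, \<open>[r / \<rho>, r]\<close> is the range of thresholds whose class contains a job of
normalized size \<open>r\<close>.\<close>

definition overlap :: "real \<Rightarrow> real \<Rightarrow> real \<Rightarrow> real \<Rightarrow> real" where
  "overlap \<rho> c d r = max 0 (min d r - max c (r / \<rho>))"

text \<open>Turns the infinite sum in \<open>class_saving\<close> into a parametrised integral,
  whose measurability in \<beta> follows from sigma-finiteness of the counting measure.\<close>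

lemma infsum_eq_integral_count_space:
  fixes f :: "'a \<Rightarrow> real"
  assumes "\<And>x. x \<in> A \<Longrightarrow> 0 \<le> f x"
  shows "infsum f A = (\<integral>x. f x \<partial>count_space A)"
proof -
  have eq: "f summable_on A \<longleftrightarrow> integrable (count_space A) f"
    using summable_on_iff_abs_summable_on_real[of f A] abs_summable_equivalent[of f A]
    by (simp add: Infinite_Set_Sum.abs_summable_on_def)
  show ?thesis
  proof (cases "f summable_on A")
    case True
    thus ?thesis using infsetsum_infsum[of f A] eq
      by (simp add: Infinite_Set_Sum.abs_summable_on_def infsetsum_def)
  next
    case False
    thus ?thesis using eq by (simp add: infsum_not_exists not_integrable_integral_eq)
  qed
qed

lemma class_volume_eq:
  assumes "finite P"
  shows "class_volume p z P \<rho> \<beta> k = (\<Sum>j\<in>P. z j * norm_size p z P j *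
           of_bool (\<beta> * \<rho> powi k \<le> p j \<and> p j < \<beta> * \<rho> powi (k + 1)))"
  unfolding class_volume_def using assms by (simp add: sum.If_cases of_bool_def if_distrib Int_def cong: if_cong)

lemma measurable_class_volume [measurable]:
  assumes "finite P"
  shows "(\<lambda>\<beta>. class_volume p z P \<rho> \<beta> k) \<in> borel_measurable borel"
  unfolding class_volume_eq[OF assms] by measurable

lemma measurable_class_threshold [measurable]:
  "(\<lambda>\<beta>. class_threshold p z P \<rho> \<beta> k) \<in> borel_measurable borel"
  unfolding class_threshold_def by measurable

lemma measurable_class_saving [measurable]:
  assumes "finite P"
  shows "class_saving p z P \<rho> \<in> borel_measurable borel"
proof -
  note [measurable] = measurable_class_volume[OF assms]
  interpret sigma_finite_measure "count_space (UNIV :: int set)"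
    by (rule sigma_finite_measure_count_space_countable) simp
  have "(\<lambda>(\<beta>, k). (min (class_volume p z P \<rho> \<beta> k) (class_threshold p z P \<rho> \<beta> k))\<^sup>2)
    \<in> borel_measurable (borel \<Otimes>\<^sub>M count_space UNIV)"
    unfolding case_prod_beta
    by (rule measurable_compose_countable'[where g = snd and I = UNIV]) simp_all
  from borel_measurable_lebesgue_integral[OF this] show ?thesis
    by (simp add: class_saving_def[abs_def] infsum_eq_integral_count_space)
qed

section \<open>Size classes for fixed \<beta>: disjointness, finite index range,
  integrability\<close>

context
  fixes p z :: "'j \<Rightarrow> real" and P :: "'j set" and \<rho> :: real
  assumes P: "finite P" "\<And>j. j \<in> P \<Longrightarrow> 0 < p j" "\<And>j. j \<in> P \<Longrightarrow> 0 \<le> z j"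
    and V: "0 < prefix_volume p z P" and \<rho>: "1 < \<rho>"
begin

lemma norm_size_pos: "j \<in> P \<Longrightarrow> 0 < norm_size p z P j"
  using P V by (simp add: norm_size_def)

lemma sum_norm_size: "(\<Sum>j\<in>P. z j * norm_size p z P j) = 1"
  using V by (simp add: norm_size_def prefix_volume_def flip: sum_divide_distrib)

lemma class_volume_nonneg: "0 \<le> class_volume p z P \<rho> \<beta> k"
  unfolding class_volume_def by (intro sum_nonneg) (auto intro!: mult_nonneg_nonneg P less_imp_le[OF norm_size_pos])

lemma class_unique:
  assumes "0 < \<beta>" "\<beta> * \<rho> powi k \<le> x" "x < \<beta> * \<rho> powi (k + 1)" "\<beta> * \<rho> powi l \<le> x" "x < \<beta> * \<rho> powi (l + 1)"
  shows "k = l"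
proof -
  have "\<not> k < l" if "\<beta> * \<rho> powi l \<le> x" "x < \<beta> * \<rho> powi (k + 1)" for k l
  proof
    assume "k < l"
    hence "\<rho> powi (k + 1) \<le> \<rho> powi l" using \<rho> by (intro power_int_increasing) auto
    hence "\<beta> * \<rho> powi (k + 1) \<le> \<beta> * \<rho> powi l" using assms by simp
    thus False using that by linarith
  qed
  from this[of l k] this[of k l] show ?thesis using assms by linarith
qed

lemma sum_class_volume_le:
  assumes "finite I" "0 < \<beta>"
  shows "(\<Sum>k\<in>I. class_volume p z P \<rho> \<beta> k) \<le> 1"
proof -
  have "(\<Sum>k\<in>I. of_bool (\<beta> * \<rho> powi k \<le> p j \<and> p j < \<beta> * \<rho> powi (k + 1))) \<le> (1::real)" for j
  proof (cases "\<exists>k\<in>I. \<beta> * \<rho> powi k \<le> p j \<and> p j < \<beta> * \<rho> powi (k + 1)")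
    case True
    then obtain l where l: "l \<in> I" "\<beta> * \<rho> powi l \<le> p j" "p j < \<beta> * \<rho> powi (l + 1)" by blast
    have "(\<Sum>k\<in>I. of_bool (\<beta> * \<rho> powi k \<le> p j \<and> p j < \<beta> * \<rho> powi (k + 1))) = (\<Sum>k\<in>I. if k = l then 1 else 0 :: real)"
      using l class_unique[OF assms(2)] by (intro sum.cong refl) auto
    also have "\<dots> = 1" using assms l by simp
    finally show ?thesis by simp
  next
    case False
    hence "(\<Sum>k\<in>I. of_bool (\<beta> * \<rho> powi k \<le> p j \<and> p j < \<beta> * \<rho> powi (k + 1))) = (0::real)"
      by (intro sum.neutral) auto
    thus ?thesis by simp
  qed
  note le = this
  have "(\<Sum>k\<in>I. class_volume p z P \<rho> \<beta> k) = (\<Sum>j\<in>P. z j * norm_size p z P j *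
     (\<Sum>k\<in>I. of_bool (\<beta> * \<rho> powi k \<le> p j \<and> p j < \<beta> * \<rho> powi (k + 1))))"
    unfolding class_volume_eq[OF P(1)] sum_distrib_left by (rule sum.swap)
  also have "\<dots> \<le> (\<Sum>j\<in>P. z j * norm_size p z P j * 1)"
    by (intro sum_mono mult_left_mono le mult_nonneg_nonneg P less_imp_le[OF norm_size_pos])
  finally show ?thesis by (simp add: sum_norm_size)
qed

text \<open>The lower size bound has exponent \<open>1 - N\<close> rather than \<open>- N\<close>
  because \<beta> may come close to \<rho>: a class with k < -N reaches up to at most \<rho> times
  \<rho>^(-N).\<close>

lemma class_saving_eq_sum:
  assumes N: "\<And>j. j \<in> P \<Longrightarrow> \<rho> powi (1 - N) \<le> p j" "\<And>j. j \<in> P \<Longrightarrow> p j < \<rho> powi N"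
    and \<beta>: "\<beta> \<in> {1..<\<rho>}"
  shows "class_saving p z P \<rho> \<beta> =
    (\<Sum>k\<in>{-N..N}. (min (class_volume p z P \<rho> \<beta> k) (class_threshold p z P \<rho> \<beta> k))\<^sup>2)"
proof -
  have "class_volume p z P \<rho> \<beta> k = 0" if k: "k \<notin> {-N..N}" for k
  proof -
    have "\<not> (\<beta> * \<rho> powi k \<le> p j \<and> p j < \<beta> * \<rho> powi (k + 1))" if j: "j \<in> P" for j
    proof (cases "N < k")
      case True
      hence "\<rho> powi N \<le> \<rho> powi k" using \<rho> by (intro power_int_increasing) auto
      also have "\<dots> \<le> \<beta> * \<rho> powi k" using \<beta> \<rho> by simp
      finally show ?thesis using N(2)[OF j] by linarith
    next
      case False
      hence "\<rho> powi (k + 1) \<le> \<rho> powi (-N)" using k \<rho> by (intro power_int_increasing) auto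
      hence "\<beta> * \<rho> powi (k + 1) \<le> \<rho> * \<rho> powi (-N)" using \<beta> \<rho> by (intro mult_mono) auto
      also have "\<dots> = \<rho> powi (1 - N)" using \<rho> by (simp add: power_int_diff power_int_minus field_simps)
      finally show ?thesis using N(1)[OF j] by linarith
    qed
    hence "{j \<in> P. \<beta> * \<rho> powi k \<le> p j \<and> p j < \<beta> * \<rho> powi (k + 1)} = {}" by blast
    thus ?thesis unfolding class_volume_def by (simp only: sum.empty)
  qed
  moreover have "0 \<le> class_threshold p z P \<rho> \<beta> k" for k
    using \<beta> \<rho> V by (simp add: class_threshold_def)
  ultimately have "class_saving p z P \<rho> \<beta> = (\<Sum>\<^sub>\<infinity>k\<in>{-N..N}. (min (class_volume p z P \<rho> \<beta> k) (class_threshold p z P \<rho> \<beta> k))\<^sup>2)"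
    unfolding class_saving_def by (intro infsum_cong_neutral) auto
  thus ?thesis by simp
qed

text \<open>A non-integrable function would have Bochner integral 0 by default, so comparing
  \<open>expected_saving\<close> with a lower bound requires integrability.\<close>

lemma integrable_class_saving:
  assumes N: "\<And>j. j \<in> P \<Longrightarrow> \<rho> powi (1 - N) \<le> p j" "\<And>j. j \<in> P \<Longrightarrow> p j < \<rho> powi N"
  shows "integrable (log_uniform \<rho>) (class_saving p z P \<rho>)"
proof -
  interpret prob_space "log_uniform \<rho>" by (rule prob_space_log_uniform) (rule \<rho>)
  have bound: "norm (class_saving p z P \<rho> \<beta>) \<le> (\<Sum>k\<in>{-N..N}. 1)" if \<beta>: "\<beta> \<in> {1..<\<rho>}" for \<beta>
  proof -
    have "class_saving p z P \<rho> \<beta> =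
      (\<Sum>k\<in>{-N..N}. (min (class_volume p z P \<rho> \<beta> k) (class_threshold p z P \<rho> \<beta> k))\<^sup>2)"
      by (rule class_saving_eq_sum) (use N \<beta> in auto)
    moreover have "norm ((min (class_volume p z P \<rho> \<beta> k) (class_threshold p z P \<rho> \<beta> k))\<^sup>2) \<le> 1" for k
    proof -
      have "class_volume p z P \<rho> \<beta> k \<le> 1" using sum_class_volume_le[of "{k}" \<beta>] \<beta> by simp
      moreover have "0 \<le> class_threshold p z P \<rho> \<beta> k"
        using \<beta> \<rho> V by (simp add: class_threshold_def)
      ultimately show ?thesis
        using class_volume_nonneg[of \<beta> k] by (simp add: power_le_one min_def)
    qed
    ultimately show ?thesis by (simp only:) (rule sum_norm_le)
  qed
  show ?thesis
  proof (rule integrable_const_bound)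
    show "AE \<beta> in log_uniform \<rho>. norm (class_saving p z P \<rho> \<beta>) \<le> (\<Sum>k\<in>{-N..N}. 1)"
      using AE_log_uniform[OF \<rho>] by eventually_elim (rule bound)
  qed (use measurable_class_saving[OF P(1)] in simp)
qed

lemma exists_class_range:
  assumes "0 < c" "c \<le> d"
  obtains N :: int where "\<And>j. j \<in> P \<Longrightarrow> \<rho> powi (1 - N) \<le> p j" "\<And>j. j \<in> P \<Longrightarrow> p j < \<rho> powi N"
    "\<rho> powi (- N) \<le> prefix_volume p z P * c" "prefix_volume p z P * d < \<rho> powi (N + 1)"
proof -
  define V where "V = prefix_volume p z P"
  \<comment> \<open>These are the finitely many numbers that \<rho>^N has to dominate; the lower
    bounds on sizes and on \<open>V * c\<close> enter through reciprocals.\<close>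
  define X where "X = {1 / (V * c), V * d} \<union> p ` P \<union> (\<lambda>j. \<rho> / p j) ` P"
  have V0: "0 < V" using V by (simp add: V_def)
  have "finite X" using P by (simp add: X_def)
  then obtain B where B: "\<And>x. x \<in> X \<Longrightarrow> x \<le> B"
    using bdd_above_finite[of X] by (auto simp: bdd_above_def)
  obtain n where "B < \<rho> ^ n" using real_arch_pow[OF \<rho>] by blast
  hence n: "x < \<rho> powi (int n)" if "x \<in> X" for x
    using B[OF that] by simp
  show ?thesis
  proof (rule that[of "int n"])
    fix j assume j: "j \<in> P"
    show "p j < \<rho> powi int n" using n[of "p j"] j by (simp add: X_def)
    have "\<rho> / p j < \<rho> powi int n" using j by (intro n) (auto simp: X_def)
    thus "\<rho> powi (1 - int n) \<le> p j"
      using \<rho> P(2)[OF j] by (simp add: power_int_diff field_simps)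
  next
    have "1 / (V * c) < \<rho> powi int n" using n[of "1 / (V * c)"] by (simp add: X_def)
    thus "\<rho> powi - int n \<le> prefix_volume p z P * c"
      using \<rho> V0 assms unfolding V_def by (simp add: power_int_minus field_simps)
    have "V * d < \<rho> powi int n" using n[of "V * d"] by (simp add: X_def)
    also have "\<dots> \<le> \<rho> powi (int n + 1)" using \<rho> by (intro power_int_increasing) auto
    finally show "prefix_volume p z P * d < \<rho> powi (int n + 1)" by (simp add: V_def)
  qed
qed

end

text \<open>A normalized size r belongs to the class with threshold \<tau> exactly when r / \<rho> <
  \<tau> \<le> r. This is therefore the first moment over the thresholds in a cell whose class
  contains r; an empty intersection gives 0 on both sides.\<close>

lemma moment_overlap:
  fixes N :: int
  assumes "1 < \<rho>" "0 < V" "0 < c" "c \<le> d" "0 < r"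
    and N: "\<rho> powi (- N) \<le> V * c" "V * d < \<rho> powi (N + 1)"
  defines "h \<equiv> \<lambda>\<beta>. \<Sum>k\<in>{-N..N}. indicator ({c..<d} \<inter> {r / \<rho><..r}) (\<beta> * \<rho> powi k / V) * (\<beta> * \<rho> powi k / V)"
  shows "integrable (log_uniform \<rho>) h \<and> (\<integral>\<beta>. h \<beta> \<partial>log_uniform \<rho>) = overlap \<rho> c d r / ln \<rho>"
proof (cases "max c (r / \<rho>) \<le> min d r")
  case True
  have "V * c \<le> V * max c (r / \<rho>)" "V * min d r \<le> V * d" using assms by (simp_all add: mult_left_mono)
  hence N': "\<rho> powi (- N) \<le> V * max c (r / \<rho>)" "V * min d r < \<rho> powi (N + 1)" using N by linarith+
  have A: "{max c (r / \<rho>)<..<min d r} \<subseteq> {c..<d} \<inter> {r / \<rho><..r}"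
    "{c..<d} \<inter> {r / \<rho><..r} \<subseteq> {max c (r / \<rho>)..min d r}" by auto
  have c: "0 < max c (r / \<rho>)" using assms by simp
  have m: "{c..<d} \<inter> {r / \<rho><..r} \<in> sets borel" by simp
  show ?thesis
    using integrable_class_moment[OF assms(1,2) c True zero_less_one m A N']
      expectation_class_moment[OF assms(1,2) c True zero_less_one m A N'] True
    unfolding h_def overlap_def by simp
next
  case False
  hence A: "{c..<d} \<inter> {r / \<rho><..r} = {}" by auto
  have "h = (\<lambda>_. 0)" unfolding h_def A by simp
  moreover have "overlap \<rho> c d r = 0"
    unfolding overlap_def using False by (intro max_absorb1) linarith
  ultimately show ?thesis by simp
qed

text \<open>The cells are disjoint, so all cross terms vanish. The induction carries along that the
  partial sum over the first \<open>i\<close> cells is zero from \<open>g i\<close> onwards.\<close>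

lemma step_square:
  fixes g w :: "nat \<Rightarrow> real"
  assumes "\<And>m. m < n \<Longrightarrow> g m \<le> g (Suc m)"
  shows "(\<Sum>m<n. w m * indicator {g m..<g (Suc m)} x)\<^sup>2 = (\<Sum>m<n. (w m)\<^sup>2 * indicator {g m..<g (Suc m)} x)"
    (is "?l n = ?r n")
proof -
  have "?l i = ?r i \<and> (g i \<le> x \<longrightarrow> (\<Sum>m<i. w m * indicator {g m..<g (Suc m)} x) = 0)" if "i \<le> n" for i
    using that
  proof (induction i)
    case (Suc i)
    thus ?case using assms[of i] by (cases "g i \<le> x") (auto simp: indicator_def power2_eq_square)
  qed simp
  thus ?thesis by blast
qed

text \<open>The linearised bound with slopes \<open>u \<tau> * \<tau>\<close> is integrated over
  \<beta>: its part linear in the volumes yields first moments, hence overlaps, and the squared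
  slopes yield second moments of the cells. In \<open>cap\<close>, \<open>K\<close> is any finite
  set of class shifts, chosen by the user of the lemma.\<close>

lemma expected_saving_ge:
  fixes p z :: "'j \<Rightarrow> real" and P :: "'j set" and \<rho> :: real and g w :: "nat \<Rightarrow> real"
  defines "r \<equiv> norm_size p z P"
  assumes P: "finite P" "\<And>j. j \<in> P \<Longrightarrow> 0 < p j" "\<And>j. j \<in> P \<Longrightarrow> 0 \<le> z j"
    and V: "0 < prefix_volume p z P" and \<rho>: "1 < \<rho>"
    and g: "0 < g 0" "\<And>m. m < n \<Longrightarrow> g m \<le> g (Suc m)" and w: "\<And>m. m < n \<Longrightarrow> 0 \<le> w m"
    and u: "\<And>x. u x = (\<Sum>m<n. w m * indicator {g m..<g (Suc m)} x)"
    and cap: "\<And>x. 0 < x \<Longrightarrow> \<exists>K::int set. finite K \<and> 2 * (u x * x) - x\<^sup>2 \<le>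
      (\<Sum>l\<in>K. (u (x * \<rho> powi l) * (x * \<rho> powi l))\<^sup>2 - (max 0 (u (x * \<rho> powi l) * (x * \<rho> powi l) - u x * x))\<^sup>2)"
  shows "(\<Sum>j\<in>P. z j * r j * (\<Sum>m<n. 2 * w m * overlap \<rho> (g m) (g (Suc m)) (r j)))
      - (\<Sum>m<n. (w m)\<^sup>2 * ((g (Suc m))\<^sup>2 - (g m)\<^sup>2) / 2) \<le> ln \<rho> * expected_saving p z P \<rho>"
proof -
  define V where "V = prefix_volume p z P"
  have V0: "0 < V" using V by (simp add: V_def)
  have L: "0 < ln \<rho>" using \<rho> by simp
  have r: "0 < r j" if "j \<in> P" for j unfolding r_def by (rule norm_size_pos[OF P V \<rho> that])
  have g_mono: "g i \<le> g j" if "i \<le> j" "j \<le> n" for i j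
    using that
  proof (induction j rule: dec_induct)
    case (step m)
    thus ?case using g(2)[of m] by simp
  qed simp
  have gm: "0 < g m" if "m \<le> n" for m using g_mono[of 0 m] g(1) that by simp
  have u0: "0 \<le> u x" for x unfolding u by (intro sum_nonneg mult_nonneg_nonneg w) auto
  have u_supp: "u x = 0" if "x < g 0 \<or> g n \<le> x" for x
    unfolding u
  proof (intro sum.neutral ballI)
    fix m assume "m \<in> {..<n}"
    hence "g 0 \<le> g m" "g (Suc m) \<le> g n" using g_mono by simp_all
    thus "w m * indicator {g m..<g (Suc m)} x = 0" using that by (auto simp: indicator_def)
  qed
  obtain N :: int where N: "\<And>j. j \<in> P \<Longrightarrow> \<rho> powi (1 - N) \<le> p j" "\<And>j. j \<in> P \<Longrightarrow> p j < \<rho> powi N"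
    "\<rho> powi (- N) \<le> V * g 0" "V * g n < \<rho> powi (N + 1)"
    unfolding V_def using exists_class_range[OF P V \<rho> g(1) g_mono[of 0 n]] by auto
  define I where "I = {-N..N}"
  define t where "t \<beta> k = \<beta> * \<rho> powi k / V" for \<beta> k
  have t_eq: "class_threshold p z P \<rho> \<beta> k = t \<beta> k" for \<beta> k
    by (simp add: t_def class_threshold_def V_def)
  define G1 where "G1 j m \<beta> = (\<Sum>k\<in>I. indicator ({g m..<g (Suc m)} \<inter> {r j / \<rho><..r j}) (t \<beta> k) * t \<beta> k)" for j m \<beta>
  define G2 where "G2 m \<beta> = (\<Sum>k\<in>I. indicator {g m..<g (Suc m)} (t \<beta> k) * (t \<beta> k)\<^sup>2)" for m \<beta>

  have lower: "(\<Sum>k\<in>I. 2 * (u (t \<beta> k) * t \<beta> k) * class_volume p z P \<rho> \<beta> k - (u (t \<beta> k) * t \<beta> k)\<^sup>2)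
      \<le> class_saving p z P \<rho> \<beta>" if \<beta>: "\<beta> \<in> {1..<\<rho>}" for \<beta>
  proof -
    define a where "a k = u (t \<beta> k) * t \<beta> k" for k
    have t_pos: "0 < t \<beta> k" for k using \<beta> \<rho> V0 by (simp add: t_def)
    have t_shift: "t \<beta> k * \<rho> powi l = t \<beta> (k + l)" for k l
      using \<rho> by (simp add: t_def power_int_add)
    \<comment> \<open>The index range covers the support of \<open>u\<close>, so restricting to
      \<open>I\<close> loses no slope.\<close>
    have a_out: "a k = 0" if k: "k \<notin> I" for k
    proof (cases "N < k")
      case True
      hence "\<rho> powi (N + 1) \<le> \<rho> powi k" using \<rho> by (intro power_int_increasing) auto
      also have "\<dots> \<le> \<beta> * \<rho> powi k" using \<beta> \<rho> by simp
      finally have "g n \<le> t \<beta> k" using N(4) V0 by (simp add: t_def field_simps)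
      thus ?thesis by (simp add: a_def u_supp)
    next
      case False
      hence "\<rho> powi (k + 1) \<le> \<rho> powi (- N)" using k \<rho> unfolding I_def by (intro power_int_increasing) auto
      moreover have "\<beta> * \<rho> powi k < \<rho> * \<rho> powi k" using \<beta> \<rho> by simp
      moreover have "\<rho> * \<rho> powi k = \<rho> powi (k + 1)" using \<rho> by (simp add: power_int_add)
      ultimately have "t \<beta> k < g 0" using N(3) V0 by (simp add: t_def field_simps)
      thus ?thesis by (simp add: a_def u_supp)
    qed
    have "(\<Sum>k\<in>I. 2 * a k * class_volume p z P \<rho> \<beta> k - (a k)\<^sup>2)
      \<le> (\<Sum>k\<in>I. (min (class_volume p z P \<rho> \<beta> k) (t \<beta> k))\<^sup>2)"
    proof (rule capped_squares_ge)
      fix k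
      obtain K :: "int set" where K: "finite K"
        "2 * a k - (t \<beta> k)\<^sup>2 \<le> (\<Sum>l\<in>K. (a (k + l))\<^sup>2 - (max 0 (a (k + l) - a k))\<^sup>2)"
        using cap[OF t_pos[of k]] unfolding t_shift a_def by blast
      define h where "h l = (a l)\<^sup>2 - (max 0 (a l - a k))\<^sup>2" for l
      have a0: "0 \<le> a l" for l using u0 t_pos[of l] by (simp add: a_def)
      have "(max 0 (a l - a k))\<^sup>2 \<le> (a l)\<^sup>2" for l
        using a0[of l] a0[of k] by (intro power_mono) auto
      hence h0: "0 \<le> h l" for l by (simp add: h_def)
      have h_out: "h l = 0" if "l \<notin> I" for l using a_out[OF that] a0[of k] by (simp add: h_def)
      \<comment> \<open>The terms \<open>h\<close> are nonnegative and vanish outside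
        \<open>I\<close>, so passing from the shifted \<open>K\<close> to \<open>I\<close> can only
        increase the sum.\<close>
      have "(\<Sum>l\<in>K. h (k + l)) = (\<Sum>l\<in>(+) k ` K. h l)" by (simp add: sum.reindex)
      also have "\<dots> = (\<Sum>l\<in>(+) k ` K \<inter> I. h l)"
        using K(1) by (intro sum.mono_neutral_right) (auto simp: h_out)
      also have "\<dots> \<le> (\<Sum>l\<in>I. h l)" by (intro sum_mono2) (auto simp: I_def h0)
      finally show "2 * a k - (t \<beta> k)\<^sup>2 \<le> (\<Sum>l\<in>I. (a l)\<^sup>2 - (max 0 (a l - a k))\<^sup>2)"
        using K(2) by (simp add: h_def)
    qed (use u0 t_pos \<beta> in \<open>auto simp: I_def a_def less_imp_le
      intro!: class_volume_nonneg[OF P V \<rho>] sum_class_volume_le[OF P V \<rho>] mult_nonneg_nonneg\<close>)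
    also have "\<dots> = class_saving p z P \<rho> \<beta>"
      unfolding I_def t_eq[symmetric]
      by (rule class_saving_eq_sum[symmetric, OF P V \<rho>]) (use N \<beta> in auto)
    finally show ?thesis by (simp add: a_def)
  qed

  have split: "(\<Sum>k\<in>I. 2 * (u (t \<beta> k) * t \<beta> k) * class_volume p z P \<rho> \<beta> k - (u (t \<beta> k) * t \<beta> k)\<^sup>2)
      = (\<Sum>j\<in>P. z j * r j * (\<Sum>m<n. 2 * w m * G1 j m \<beta>)) - (\<Sum>m<n. (w m)\<^sup>2 * G2 m \<beta>)" for \<beta>
  proof -
    \<comment> \<open>Membership of job \<open>j\<close> in class \<open>k\<close> becomes a
      condition on the threshold \<open>t \<beta> k\<close> alone, as required for the moment
      formulas.\<close>
    have ind: "indicator {g m..<g (Suc m)} (t \<beta> k) * of_bool (\<beta> * \<rho> powi k \<le> p j \<and> p j < \<beta> * \<rho> powi (k + 1))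
        = (indicator ({g m..<g (Suc m)} \<inter> {r j / \<rho><..r j}) (t \<beta> k) :: real)" for j m k
      using V0 \<rho> by (auto simp: indicator_def t_def r_def norm_size_def V_def[symmetric] power_int_add field_simps)
    have product: "2 * ((\<Sum>m<n. X m) * s) * (\<Sum>j\<in>P. Y j) = (\<Sum>j\<in>P. \<Sum>m<n. 2 * X m * s * Y j)"
      for X :: "nat \<Rightarrow> real" and Y s
      by (subst sum.swap) (simp add: sum_distrib_left sum_distrib_right mult_ac)
    have "2 * (u (t \<beta> k) * t \<beta> k) * class_volume p z P \<rho> \<beta> k
      = (\<Sum>j\<in>P. \<Sum>m<n. z j * r j * (2 * w m * (indicator ({g m..<g (Suc m)} \<inter> {r j / \<rho><..r j}) (t \<beta> k) * t \<beta> k)))" for k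
      unfolding class_volume_eq[OF P(1)] u ind[symmetric] r_def[symmetric] product
      by (intro sum.cong refl) (simp only: mult_ac)
    hence 1: "(\<Sum>k\<in>I. 2 * (u (t \<beta> k) * t \<beta> k) * class_volume p z P \<rho> \<beta> k)
      = (\<Sum>j\<in>P. z j * r j * (\<Sum>m<n. 2 * w m * G1 j m \<beta>))"
      unfolding G1_def sum_distrib_left
      by (simp only:) (subst sum.swap, intro sum.cong refl, rule sum.swap)
    have "(u x)\<^sup>2 = (\<Sum>m<n. (w m)\<^sup>2 * indicator {g m..<g (Suc m)} x)" for x
      unfolding u by (rule step_square) (rule g(2))
    hence 2: "(\<Sum>k\<in>I. (u (t \<beta> k) * t \<beta> k)\<^sup>2) = (\<Sum>m<n. (w m)\<^sup>2 * G2 m \<beta>)"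
      unfolding G2_def power_mult_distrib sum_distrib_left
      by (simp only: sum_distrib_right mult.assoc) (rule sum.swap)
    show ?thesis using 1 2 by (simp add: sum_subtractf)
  qed

  have G1: "integrable (log_uniform \<rho>) (G1 j m) \<and> (\<integral>\<beta>. G1 j m \<beta> \<partial>log_uniform \<rho>) = overlap \<rho> (g m) (g (Suc m)) (r j) / ln \<rho>"
    and G2: "integrable (log_uniform \<rho>) (G2 m) \<and> (\<integral>\<beta>. G2 m \<beta> \<partial>log_uniform \<rho>) = ((g (Suc m))\<^sup>2 - (g m)\<^sup>2) / (2 * ln \<rho>)"
    if m: "m < n" and j: "j \<in> P" for j m
  proof -
    have "V * g 0 \<le> V * g m" "V * g (Suc m) \<le> V * g n"
      using V0 m g_mono[of 0 m] g_mono[of "Suc m" n] by simp_all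
    hence N': "\<rho> powi (- N) \<le> V * g m" "V * g (Suc m) < \<rho> powi (N + 1)" using N(3,4) by linarith+
    show "integrable (log_uniform \<rho>) (G1 j m) \<and> (\<integral>\<beta>. G1 j m \<beta> \<partial>log_uniform \<rho>) = overlap \<rho> (g m) (g (Suc m)) (r j) / ln \<rho>"
      using moment_overlap[OF \<rho> V0 gm g(2) r N', of j] m j by (simp add: G1_def[abs_def] t_def I_def)
    have A: "{g m<..<g (Suc m)} \<subseteq> {g m..<g (Suc m)}" "{g m..<g (Suc m)} \<subseteq> {g m..g (Suc m)}" by auto
    show "integrable (log_uniform \<rho>) (G2 m) \<and> (\<integral>\<beta>. G2 m \<beta> \<partial>log_uniform \<rho>) = ((g (Suc m))\<^sup>2 - (g m)\<^sup>2) / (2 * ln \<rho>)"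
      using integrable_class_moment[OF \<rho> V0 gm g(2) pos2 _ A N']
        expectation_class_moment[OF \<rho> V0 gm g(2) pos2 _ A N'] m
      by (simp add: G2_def[abs_def] t_def I_def)
  qed
  \<comment> \<open>Positive volume supplies a job that discharges the premise
    \<open>j \<in> P\<close> which \<open>G2\<close> shares with \<open>G1\<close>.\<close>
  have "P \<noteq> {}" using V by (auto simp: prefix_volume_def)
  then obtain j0 where j0: "j0 \<in> P" by blast

  have bochner: "has_bochner_integral (log_uniform \<rho>) (\<lambda>\<beta>. (\<Sum>j\<in>P. z j * r j * (\<Sum>m<n. 2 * w m * G1 j m \<beta>)) - (\<Sum>m<n. (w m)\<^sup>2 * G2 m \<beta>))
     ((\<Sum>j\<in>P. z j * r j * (\<Sum>m<n. 2 * w m * (overlap \<rho> (g m) (g (Suc m)) (r j) / ln \<rho>)))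
       - (\<Sum>m<n. (w m)\<^sup>2 * (((g (Suc m))\<^sup>2 - (g m)\<^sup>2) / (2 * ln \<rho>))))"
    using G1 G2[OF _ j0]
    by (intro has_bochner_integral_diff has_bochner_integral_sum has_bochner_integral_mult_right)
      (auto simp: has_bochner_integral_iff)
  hence "integrable (log_uniform \<rho>) (\<lambda>\<beta>. (\<Sum>j\<in>P. z j * r j * (\<Sum>m<n. 2 * w m * G1 j m \<beta>)) - (\<Sum>m<n. (w m)\<^sup>2 * G2 m \<beta>))" by (simp add: has_bochner_integral_iff)
  hence "(\<integral>\<beta>. (\<Sum>j\<in>P. z j * r j * (\<Sum>m<n. 2 * w m * G1 j m \<beta>)) - (\<Sum>m<n. (w m)\<^sup>2 * G2 m \<beta>) \<partial>log_uniform \<rho>)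
      \<le> expected_saving p z P \<rho>"
    unfolding expected_saving_def
  proof (rule integral_mono_AE)
    show "integrable (log_uniform \<rho>) (class_saving p z P \<rho>)"
      by (rule integrable_class_saving[OF P V \<rho> N(1,2)])
    show "AE \<beta> in log_uniform \<rho>. (\<Sum>j\<in>P. z j * r j * (\<Sum>m<n. 2 * w m * G1 j m \<beta>)) - (\<Sum>m<n. (w m)\<^sup>2 * G2 m \<beta>)
      \<le> class_saving p z P \<rho> \<beta>"
      using AE_log_uniform[OF \<rho>] by eventually_elim (use lower split in auto)
  qed
  also have "(\<integral>\<beta>. (\<Sum>j\<in>P. z j * r j * (\<Sum>m<n. 2 * w m * G1 j m \<beta>)) - (\<Sum>m<n. (w m)\<^sup>2 * G2 m \<beta>) \<partial>log_uniform \<rho>) = (\<Sum>j\<in>P. z j * r j * (\<Sum>m<n. 2 * w m * (overlap \<rho> (g m) (g (Suc m)) (r j) / ln \<rho>)))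
       - (\<Sum>m<n. (w m)\<^sup>2 * (((g (Suc m))\<^sup>2 - (g m)\<^sup>2) / (2 * ln \<rho>)))"
    using bochner by (simp only: has_bochner_integral_iff)
  also have "\<dots> = ((\<Sum>j\<in>P. z j * r j * (\<Sum>m<n. 2 * w m * overlap \<rho> (g m) (g (Suc m)) (r j)))
      - (\<Sum>m<n. (w m)\<^sup>2 * ((g (Suc m))\<^sup>2 - (g m)\<^sup>2) / 2)) / ln \<rho>"
    by (simp add: sum_divide_distrib sum_distrib_left diff_divide_distrib right_diff_distrib sum_subtractf mult.assoc)
  finally show ?thesis using L by (simp add: field_simps)
qed

subsection \<open>The dual certificate\<close>

text \<open>For even \<open>n\<close> the Lagrange remainder is nonnegative whatever the sign of
  \<open>x\<close>; a negative \<open>x\<close> gives upper bounds on exp.\<close>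

lemma exp_ge_even_partial_sum:
  fixes x :: real
  assumes "even n"
  shows "(\<Sum>m<n. x ^ m / fact m) \<le> exp x"
proof -
  obtain t where "exp x = (\<Sum>m<n. x ^ m / fact m) + exp t / fact n * x ^ n"
    using Maclaurin_exp_le[of x n] by blast
  moreover have "0 \<le> exp t / fact n * x ^ n"
    using assms by (intro mult_nonneg_nonneg zero_le_even_power) auto
  ultimately show ?thesis by linarith
qed

text \<open>The final inequality is affine in ln \<rho>, which is about 0.7514, so a rational
  enclosure suffices.\<close>

lemma ln_ratio_bounds: "3/4 \<le> ln (53/25::real)" "ln (53/25::real) \<le> 753/1000"
proof -
  have even: "even (6::nat)" by simp
  have "25/53 \<le> exp (- (3/4)::real)"
    by (rule order.trans[OF _ exp_ge_even_partial_sum[OF even]])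
      (simp add: eval_nat_numeral power_divide)
  hence "exp (3/4) \<le> (53/25::real)" by (simp add: exp_minus field_simps)
  thus "3/4 \<le> ln (53/25::real)" by (subst ln_ge_iff) auto
  have "53/25 \<le> exp (753/1000::real)"
    by (rule order.trans[OF _ exp_ge_even_partial_sum[OF even]])
      (simp add: eval_nat_numeral power_divide)
  hence "ln (53/25::real) \<le> ln (exp (753/1000))" by (subst ln_le_cancel_iff) auto
  thus "ln (53/25::real) \<le> 753/1000" by simp
qed

text \<open>The step function \<open>u\<close> has value \<open>grid_weight m\<close> on \<open>[grid m, grid (m + 1))\<close> for \<open>m < 9\<close>. The
numbers come from a numerical maximisation of the slack in \<open>dual_pointwise\<close> below, which is about
\<open>0.007\<close>. The grid is invariant under multiplication by \<open>\<rho>\<close>, so that three consecutive classes always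
have weights \<open>i\<close>, \<open>i + 3\<close>, \<open>i + 6\<close>.\<close>

definition grid :: "nat \<Rightarrow> real" where
  "grid m = [11/50, 27/100, 17/50] ! (m mod 3) * (53/25) ^ (m div 3)"

definition grid_weight :: "nat \<Rightarrow> real" where
  "grid_weight m = [13/100, 1/5, 1/4, 31/100, 7/20, 19/50, 1/4, 3/20, 3/50] ! m"

lemma grid_eq:
  "grid 0 = 11/50"
  "grid (Suc 0) = 27/100"
  "grid 2 = 17/50"
  "grid 3 = 583/1250"
  "grid 4 = 1431/2500"
  "grid 5 = 901/1250"
  "grid 6 = 30899/31250"
  "grid 7 = 75843/62500"
  "grid 8 = 47753/31250"
  "grid 9 = 1637647/781250"
  "grid 10 = 4019679/1562500"
  "grid 11 = 2530909/781250"
  by (simp_all add: grid_def power_divide)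

lemma grid_weight_eq:
  "grid_weight 0 = 13/100" "grid_weight (Suc 0) = 1/5" "grid_weight 2 = 1/4" "grid_weight 3 = 31/100" "grid_weight 4 = 7/20" "grid_weight 5 = 19/50" "grid_weight 6 = 1/4"
  "grid_weight 7 = 3/20" "grid_weight 8 = 3/50"
  by (simp_all add: grid_weight_def)

lemma sum_lessThan_9: "(\<Sum>m<9. f m) = f 0 + f (Suc 0) + f 2 + f 3 + f 4 + f 5 + f 6 + f 7 + (f 8 :: real)"
  by (simp add: eval_nat_numeral)

text \<open>Replaces the only nonlinear term of the pointwise inequality by lines in
  \<open>r\<close>, tangent where \<theta> = 1 - s / r.\<close>

lemma square_pos_part_ge:
  fixes r s \<theta> :: real
  assumes "0 < r" "0 \<le> \<theta>"
  shows "2 * \<theta> * (r - s) - \<theta>\<^sup>2 * r \<le> (max 0 (r - s))\<^sup>2 / r"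
proof (cases "s \<le> r")
  case True
  have "0 \<le> (r - s - \<theta> * r)\<^sup>2" by simp
  thus ?thesis using assms True by (simp add: field_simps power2_eq_square max_def)
next
  case False
  have "2 * \<theta> * (r - s) \<le> 0" using False assms by (simp add: mult_nonneg_nonpos)
  moreover have "0 \<le> \<theta>\<^sup>2 * r" using assms by simp
  ultimately show ?thesis using False by (simp add: max_def)
qed

lemma overlap_nonneg: "0 \<le> overlap \<rho> c d r"
  by (simp add: overlap_def)

lemma overlap_lower:
  assumes "x \<le> d - c" "x \<le> d - r / \<rho>" "x \<le> r - c" "x \<le> r - r / \<rho>"
  shows "x \<le> overlap \<rho> c d r"
  using assms by (auto simp: overlap_def)

text \<open>The claim is multiplied by \<open>L\<close> and written as an integral over the measure
  with masses \<open>z j * r j\<close>; this is its integrand. Since the total mass is 1, the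
  constants of both linear bounds appear unchanged.\<close>

lemma dual_pointwise:
  fixes r L :: real
  assumes r: "0 < r" and L: "3/4 \<le> L" "L \<le> 753/1000"
  shows "0 \<le> (\<Sum>m<9. 2 * grid_weight m * overlap (53/25) (grid m) (grid (Suc m)) r)
            - (\<Sum>m<9. (grid_weight m)\<^sup>2 * ((grid (Suc m))\<^sup>2 - (grid m)\<^sup>2) / 2)
            + L * (823/625 * ((max 0 (r - 9/10))\<^sup>2 / r + (2 * (9/10) - (9/10)\<^sup>2)) - (2 - 823/625) * r - 1)"
proof -
  define X where "X = (max 0 (r - 9/10))\<^sup>2 / r"
  define B where "B = 823/625 * (X + (2 * (9/10) - (9/10)\<^sup>2)) - (2 - 823/625) * r - 1"
  define U where "U = (\<Sum>m<9. 2 * grid_weight m * overlap (53/25) (grid m) (grid (Suc m)) r)"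
  have X0: "0 \<le> X" using r by (simp add: X_def)
  \<comment> \<open>Tangents of the convex function \<open>(r - s)\<^sup>2 / r\<close>; the values of \<open>\<theta>\<close> below are those of
    \<open>1 - s / r\<close> at intermediate points of the respective interval.\<close>
  have X: "2 * \<theta> * r - 9/5 * \<theta> - \<theta> * \<theta> * r \<le> X" if "0 \<le> \<theta>" for \<theta>
    using square_pos_part_ge[of r \<theta> "9/10"] r that unfolding X_def by (simp add: power2_eq_square algebra_simps)
  have S: "(\<Sum>m<9. (grid_weight m)\<^sup>2 * ((grid (Suc m))\<^sup>2 - (grid m)\<^sup>2) / 2) \<le> 333/4000"
    unfolding sum_lessThan_9 by (simp add: grid_eq grid_weight_eq power_divide flip: numeral_2_eq_2)
  define v where "v m = overlap (53/25) (grid m) (grid (Suc m)) r" for m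
  have v0: "0 \<le> v m" for m by (simp add: v_def overlap_nonneg)
  have U_eq: "U = 13/50 * v 0 + 2/5 * v (Suc 0) + 1/2 * v 2 + 31/50 * v 3 + 7/10 * v 4
      + 19/25 * v 5 + 1/2 * v 6 + 3/10 * v 7 + 3/25 * v 8"
    unfolding U_def sum_lessThan_9 v_def by (simp add: grid_weight_eq)
  have U0: "0 \<le> U" unfolding U_eq using v0 by simp
  \<comment> \<open>With s = 9/10, 81477/62500 is \<alpha> (2 s - s^2), and 427/625 is 2 -
    \<alpha>.\<close>
  have B_eq: "B = 823/625 * X + 81477/62500 - 427/625 * r - 1"
    unfolding B_def by (simp add: power2_eq_square field_simps)
  note V0 = v0[of 0] v0[of "Suc 0"] v0[of 2] v0[of 3] v0[of 4] v0[of 5] v0[of 6] v0[of 7] v0[of 8]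
  \<comment> \<open>The grid is invariant under \<rho>, so between neighbouring grid points neither
    \<open>r\<close> nor r / \<rho> crosses a cell boundary and every overlap is linear in
    \<open>r\<close>. The points \<open>grid 10\<close> and \<open>grid 11\<close> are \<rho> times
    \<open>grid 7\<close> and \<open>grid 8\<close>.\<close>
  consider (below) "r \<le> grid 0"
    | (c0) "grid 0 \<le> r" "r \<le> grid (Suc 0)"
    | (c1) "grid (Suc 0) \<le> r" "r \<le> grid 2"
    | (c2) "grid 2 \<le> r" "r \<le> grid 3"
    | (c3) "grid 3 \<le> r" "r \<le> grid 4"
    | (c4) "grid 4 \<le> r" "r \<le> grid 5"
    | (c5) "grid 5 \<le> r" "r \<le> grid 6"
    | (c6) "grid 6 \<le> r" "r \<le> grid 7"
    | (c7) "grid 7 \<le> r" "r \<le> grid 8"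
    | (c8) "grid 8 \<le> r" "r \<le> grid 9"
    | (c9) "grid 9 \<le> r" "r \<le> grid 10"
    | (c10) "grid 10 \<le> r" "r \<le> grid 11"
    | (above) "grid 11 \<le> r"
    by linarith
  \<comment> \<open>The expression is affine in \<open>L\<close>, so the two ends of the range of
    \<open>L\<close> are enough.\<close>
  then have "0 \<le> U - 333/4000 + 3/4 * B \<and> 0 \<le> U - 333/4000 + 753/1000 * B"
  proof cases
    case below
    then show ?thesis using X0 U0 B_eq unfolding grid_eq by (intro conjI; linarith)
  next
    case c0
    have "r - grid 0 \<le> v 0"
      unfolding v_def by (rule overlap_lower; use c0 in \<open>simp add: grid_eq flip: numeral_2_eq_2\<close>)+
    then have "13/50 * r - 143/2500 \<le> U"
      using v0[of "Suc 0"] v0[of 2] v0[of 3] v0[of 4] v0[of 5] v0[of 6] v0[of 7] v0[of 8] U_eq unfolding grid_eq by linarith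
    then show ?thesis using c0 X0 B_eq unfolding grid_eq by (intro conjI; linarith)
  next
    case c1
    have "grid (Suc 0) - grid 0 \<le> v 0" "r - grid (Suc 0) \<le> v (Suc 0)"
      unfolding v_def by (rule overlap_lower; use c1 in \<open>simp add: grid_eq flip: numeral_2_eq_2\<close>)+
    then have "2/5 * r - 19/200 \<le> U"
      using v0[of 2] v0[of 3] v0[of 4] v0[of 5] v0[of 6] v0[of 7] v0[of 8] U_eq unfolding grid_eq by linarith
    then show ?thesis using c1 X0 B_eq unfolding grid_eq by (intro conjI; linarith)
  next
    case c2
    have "grid (Suc 0) - grid 0 \<le> v 0" "grid 2 - grid (Suc 0) \<le> v (Suc 0)" "r - grid 2 \<le> v 2"
      unfolding v_def by (rule overlap_lower; use c2 in \<open>simp add: grid_eq flip: numeral_2_eq_2\<close>)+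
    then have "1/2 * r - 129/1000 \<le> U"
      using v0[of 3] v0[of 4] v0[of 5] v0[of 6] v0[of 7] v0[of 8] U_eq unfolding grid_eq by linarith
    then show ?thesis using c2 X0 B_eq unfolding grid_eq by (intro conjI; linarith)
  next
    case c3
    \<comment> \<open>From \<open>grid 3\<close> on, r / \<rho> has passed \<open>grid 0\<close>,
      and the lower cells are lost one after another.\<close>
    have "grid (Suc 0) - 25/53 * r \<le> v 0" "grid 2 - grid (Suc 0) \<le> v (Suc 0)" "grid 3 - grid 2 \<le> v 2" "r - grid 3 \<le> v 3"
      unfolding v_def by (rule overlap_lower; use c3 in \<open>simp add: grid_eq flip: numeral_2_eq_2\<close>)+
    then have "659/1325 * r - 15971/125000 \<le> U"
      using v0[of 4] v0[of 5] v0[of 6] v0[of 7] v0[of 8] U_eq unfolding grid_eq by linarith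
    then show ?thesis using c3 X0 B_eq unfolding grid_eq by (intro conjI; linarith)
  next
    case c4
    have "grid 2 - 25/53 * r \<le> v (Suc 0)" "grid 3 - grid 2 \<le> v 2" "grid 4 - grid 3 \<le> v 3" "r - grid 4 \<le> v 4"
      unfolding v_def by (rule overlap_lower; use c4 in \<open>simp add: grid_eq flip: numeral_2_eq_2\<close>)+
    then have "271/530 * r - 1697/12500 \<le> U"
      using v0[of 0] v0[of 5] v0[of 6] v0[of 7] v0[of 8] U_eq unfolding grid_eq by linarith
    then show ?thesis using c4 X0 B_eq unfolding grid_eq by (intro conjI; linarith)
  next
    case c5
    have "grid 3 - 25/53 * r \<le> v 2" "grid 4 - grid 3 \<le> v 3" "grid 5 - grid 4 \<le> v 4" "r - grid 5 \<le> v 5"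
      unfolding v_def by (rule overlap_lower; use c5 in \<open>simp add: grid_eq flip: numeral_2_eq_2\<close>)+
    then have "1389/2650 * r - 9063/62500 \<le> U"
      using v0[of 0] v0[of "Suc 0"] v0[of 6] v0[of 7] v0[of 8] U_eq unfolding grid_eq by linarith
    then show ?thesis using c5 X0 X[of "1/50", simplified] X[of "7/100", simplified] B_eq unfolding grid_eq by (intro conjI; linarith)
  next
    case c6
    have "grid 4 - 25/53 * r \<le> v 3" "grid 5 - grid 4 \<le> v 4" "grid 6 - grid 5 \<le> v 5" "r - grid 6 \<le> v 6"
      unfolding v_def by (rule overlap_lower; use c6 in \<open>simp add: grid_eq flip: numeral_2_eq_2\<close>)+
    then have "11/53 * r + 131281/781250 \<le> U"
      using v0[of 0] v0[of "Suc 0"] v0[of 2] v0[of 7] v0[of 8] U_eq unfolding grid_eq by linarith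
    then show ?thesis using c6 X0 X[of "7/50", simplified] X[of "11/50", simplified] B_eq unfolding grid_eq by (intro conjI; linarith)
  next
    case c7
    have "grid 5 - 25/53 * r \<le> v 4" "grid 6 - grid 5 \<le> v 5" "grid 7 - grid 6 \<le> v 6" "r - grid 7 \<le> v 7"
      unfolding v_def by (rule overlap_lower; use c7 in \<open>simp add: grid_eq flip: numeral_2_eq_2\<close>)+
    then have "-8/265 * r + 713327/1562500 \<le> U"
      using v0[of 0] v0[of "Suc 0"] v0[of 2] v0[of 3] v0[of 8] U_eq unfolding grid_eq by linarith
    then show ?thesis using c7 X0 X[of "3/10", simplified] X[of "19/50", simplified] B_eq unfolding grid_eq by (intro conjI; linarith)
  next
    case c8
    have "grid 6 - 25/53 * r \<le> v 5" "grid 7 - grid 6 \<le> v 6" "grid 8 - grid 7 \<le> v 7" "r - grid 8 \<le> v 8"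
      unfolding v_def by (rule overlap_lower; use c8 in \<open>simp add: grid_eq flip: numeral_2_eq_2\<close>)+
    then have "-316/1325 * r + 1210679/1562500 \<le> U"
      using v0[of 0] v0[of "Suc 0"] v0[of 2] v0[of 3] v0[of 4] U_eq unfolding grid_eq by linarith
    then show ?thesis using c8 X0 X[of "23/50", simplified] X[of "27/50", simplified] B_eq unfolding grid_eq by (intro conjI; linarith)
  next
    case c9
    have "grid 7 - 25/53 * r \<le> v 6" "grid 8 - grid 7 \<le> v 7" "grid 9 - grid 8 \<le> v 8"
      unfolding v_def by (rule overlap_lower; use c9 in \<open>simp add: grid_eq flip: numeral_2_eq_2\<close>)+
    then have "-25/106 * r + 15025341/19531250 \<le> U"
      using v0[of 0] v0[of "Suc 0"] v0[of 2] v0[of 3] v0[of 4] v0[of 5] U_eq unfolding grid_eq by linarith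
    then show ?thesis using c9 X0 X[of "59/100", simplified] X[of "63/100", simplified] B_eq unfolding grid_eq by (intro conjI; linarith)
  next
    case c10
    have "grid 8 - 25/53 * r \<le> v 7" "grid 9 - grid 8 \<le> v 8"
      unfolding v_def by (rule overlap_lower; use c10 in \<open>simp add: grid_eq flip: numeral_2_eq_2\<close>)+
    then have "-15/106 * r + 20570307/39062500 \<le> U"
      using v0[of 0] v0[of "Suc 0"] v0[of 2] v0[of 3] v0[of 4] v0[of 5] v0[of 6] U_eq unfolding grid_eq by linarith
    then show ?thesis using c10 X0 X[of "67/100", simplified] X[of "71/100", simplified] B_eq unfolding grid_eq by (intro conjI; linarith)
  next
    case above
    \<comment> \<open>At this \<theta> the factor 823/625 (2 \<theta> - \<theta>^2) exceeds 427/625,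
      so the lower bound on \<open>B\<close> grows with \<open>r\<close> and the overlaps can be
      bounded by 0.\<close>
    then show ?thesis using U0 X[of "37/50", simplified] B_eq unfolding grid_eq by (intro conjI; linarith)
  qed
  moreover have "3/4 * B \<le> L * B \<or> 753/1000 * B \<le> L * B"
    using mult_right_mono[OF L(1), of B] mult_right_mono_neg[OF L(2), of B] by (cases "0 \<le> B") auto
  ultimately have "0 \<le> U - 333/4000 + L * B" by linarith
  then show ?thesis using S unfolding U_def B_def X_def by linarith
qed

section \<open>Admissibility of the slopes given by the step function\<close>

lemma grid_pos: "0 < grid m"
proof -
  have "m mod 3 = 0 \<or> m mod 3 = 1 \<or> m mod 3 = 2" by arith
  thus ?thesis by (auto simp: grid_def)
qed

lemma grid_shift: "grid (m + 3 * k) = grid m * (53/25) ^ k"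
  by (simp add: grid_def power_add)

lemma grid_less_Suc: "grid m < grid (Suc m)"
proof -
  have "grid i < grid (Suc i)" if "i < 3" for i
  proof -
    have "i = 0 \<or> i = Suc 0 \<or> i = 2" using that by arith
    thus ?thesis by (auto simp: grid_eq simp flip: numeral_2_eq_2)
  qed
  hence "grid (m mod 3) * (53/25) ^ (m div 3) < grid (Suc (m mod 3)) * (53/25) ^ (m div 3)"
    by (intro mult_strict_right_mono) auto
  hence "grid (m mod 3 + 3 * (m div 3)) < grid (Suc (m mod 3) + 3 * (m div 3))"
    unfolding grid_shift .
  thus ?thesis by simp
qed

lemma grid_mono: "i \<le> j \<Longrightarrow> grid i \<le> grid j"
  by (rule lift_Suc_mono_le[of grid]) (simp_all add: less_imp_le grid_less_Suc)

lemma grid_weight_nonneg: "m < 9 \<Longrightarrow> 0 \<le> grid_weight m"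
  by (auto simp: grid_weight_def eval_nat_numeral less_Suc_eq)

text \<open>For thresholds y \<rho>^l with y in the cell of \<open>grid i\<close>, the slopes are
  \<open>y * W l\<close>. After division by y the cap condition is hardest at the left end y =
  \<open>grid i\<close>, which leaves nine rational inequalities.\<close>

lemma weight_cap:
  fixes i k :: nat
  defines "W \<equiv> \<lambda>l. grid_weight (3 * l + i) * (53/25) ^ l"
  assumes "i < 3" "k < 3"
  shows "2 * W k \<le> grid i * (((53/25) ^ k)\<^sup>2 + (\<Sum>l<3. (W l)\<^sup>2 - (max 0 (W l - W k))\<^sup>2))"
proof -
  have "i = 0 \<or> i = Suc 0 \<or> i = 2" "k = 0 \<or> k = Suc 0 \<or> k = 2" using assms by arith+
  moreover have "(\<Sum>l<3. f l) = f 0 + f (Suc 0) + (f 2 :: real)" for f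
    by (simp add: eval_nat_numeral)
  ultimately show ?thesis
    unfolding W_def by (elim disjE) (simp_all add: grid_eq grid_weight_eq power2_eq_square flip: numeral_2_eq_2)
qed

lemma step_eq:
  assumes "m < 9" "grid m \<le> x" "x < grid (Suc m)"
  shows "(\<Sum>m<9. grid_weight m * indicator {grid m..<grid (Suc m)} x) = grid_weight m"
proof -
  have "x \<in> {grid l..<grid (Suc l)} \<longleftrightarrow> l = m" for l
    using assms grid_mono[of "Suc l" m] grid_mono[of "Suc m" l] by (cases l m rule: linorder_cases) auto
  hence "(\<Sum>m<9. grid_weight m * indicator {grid m..<grid (Suc m)} x) = (\<Sum>l<9. if l = m then grid_weight l else 0)"
    by (intro sum.cong refl) (simp add: indicator_def)
  thus ?thesis using assms by simp
qed

text \<open>A threshold in the support of \<open>u\<close> is scaled back by \<rho>^k to some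
  \<open>y\<close> among the first three cells. The shifts \<open>l - k\<close> with l < 3 then
  visit the cells i, i + 3 and i + 6, whose weights are those in \<open>weight_cap\<close>.\<close>

lemma step_cap:
  fixes x :: real
  defines "u \<equiv> \<lambda>x. \<Sum>m<9. grid_weight m * indicator {grid m..<grid (Suc m)} x"
  assumes x: "0 < x"
  shows "\<exists>K::int set. finite K \<and> 2 * (u x * x) - x\<^sup>2 \<le> (\<Sum>l\<in>K.
      (u (x * (53/25) powi l) * (x * (53/25) powi l))\<^sup>2
      - (max 0 (u (x * (53/25) powi l) * (x * (53/25) powi l) - u x * x))\<^sup>2)"
proof (cases "\<exists>m<9. grid m \<le> x \<and> x < grid (Suc m)")
  case False
  hence "u x = 0" unfolding u_def by (intro sum.neutral) (auto simp: indicator_def)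
  thus ?thesis by (intro exI[of _ "{}"]) simp
next
  case True
  then obtain m where m: "m < 9" "grid m \<le> x" "x < grid (Suc m)" by blast
  define i k y where "i = m mod 3" and "k = m div 3" and "y = x * (53/25) powi (- int k)"
  define W where "W l = grid_weight (3 * l + i) * (53/25) ^ l" for l
  have ik: "i < 3" "k < 3" "m = i + 3 * k" using m(1) by (auto simp: i_def k_def)
  have y0: "0 < y" using x by (simp add: y_def)
  have shift: "x * (53/25) powi (int l - int k) = y * (53/25) ^ l" for l
    by (simp add: y_def power_int_diff power_int_minus divide_simps)
  have "grid i * (53/25) ^ k \<le> y * (53/25) ^ k" "y * (53/25) ^ k < grid (Suc i) * (53/25) ^ k"
    using m grid_shift[of i k] grid_shift[of "Suc i" k] shift[of k] by (simp_all add: ik(3))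
  hence y: "grid i \<le> y" "y < grid (Suc i)" by simp_all
  have a: "u (y * (53/25) ^ l) * (y * (53/25) ^ l) = y * W l" if "l < 3" for l
  proof -
    have "grid (i + 3 * l) \<le> y * (53/25) ^ l" "y * (53/25) ^ l < grid (Suc (i + 3 * l))"
      using y grid_shift[of i l] grid_shift[of "Suc i" l] by simp_all
    hence "u (y * (53/25) ^ l) = grid_weight (i + 3 * l)"
      unfolding u_def using that ik(1) by (intro step_eq) auto
    thus ?thesis by (simp add: W_def add.commute)
  qed
  have x_eq: "x = y * (53/25) ^ k" using shift[of k] by simp
  have "2 * (y * W k) \<le> y * (grid i * (((53/25) ^ k)\<^sup>2 + (\<Sum>l<3. (W l)\<^sup>2 - (max 0 (W l - W k))\<^sup>2)))"
    using weight_cap[OF ik(1,2)] y0 unfolding W_def by simp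
  also have "\<dots> \<le> y * (y * (((53/25) ^ k)\<^sup>2 + (\<Sum>l<3. (W l)\<^sup>2 - (max 0 (W l - W k))\<^sup>2)))"
  proof (intro mult_left_mono mult_right_mono y(1) add_nonneg_nonneg sum_nonneg)
    fix l assume "l \<in> {..<3::nat}"
    hence "0 \<le> W l" "0 \<le> W k" unfolding W_def using ik by (auto intro!: mult_nonneg_nonneg grid_weight_nonneg)
    thus "0 \<le> (W l)\<^sup>2 - (max 0 (W l - W k))\<^sup>2" by (simp add: power_mono)
  qed (use y0 in auto)
  also have "\<dots> = (y * (53/25) ^ k)\<^sup>2 + (\<Sum>l<3. (y * W l)\<^sup>2 - (y * max 0 (W l - W k))\<^sup>2)"
    by (simp add: power2_eq_square algebra_simps sum_distrib_left sum_subtractf)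
  also have "(\<Sum>l<3. (y * W l)\<^sup>2 - (y * max 0 (W l - W k))\<^sup>2) = (\<Sum>l<3. (y * W l)\<^sup>2 - (max 0 (y * W l - y * W k))\<^sup>2)"
    using y0 by (intro sum.cong refl) (auto simp: max_def right_diff_distrib)
  finally have "2 * (u x * x) - x\<^sup>2 \<le> (\<Sum>l<3. (u (y * (53/25) ^ l) * (y * (53/25) ^ l))\<^sup>2
      - (max 0 (u (y * (53/25) ^ l) * (y * (53/25) ^ l) - u x * x))\<^sup>2)"
    using ik(2) by (simp add: a x_eq)
  also have "\<dots> = (\<Sum>l\<in>(\<lambda>l. int l - int k) ` {..<3}.
      (u (x * (53/25) powi l) * (x * (53/25) powi l))\<^sup>2
      - (max 0 (u (x * (53/25) powi l) * (x * (53/25) powi l) - u x * x))\<^sup>2)"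
    by (subst sum.reindex) (simp_all add: inj_on_def shift)
  finally show ?thesis by blast
qed

subsection \<open>The configuration bound\<close>

text \<open>A sum of nonnegative squares is at most the square of the sum. If some
  \<open>r j\<close> exceeds \<open>s\<close>, the total excess drops \<open>s\<close> at least
  once, so it is at most \<open>sum r A - s\<close>; otherwise the left side is 0.\<close>

lemma sum_excess_squares_le:
  fixes r :: "'a \<Rightarrow> real"
  assumes "finite A" "\<And>j. j \<in> A \<Longrightarrow> 0 \<le> r j" "0 \<le> s"
  shows "(\<Sum>j\<in>A. (max 0 (r j - s))\<^sup>2) \<le> (sum r A - s)\<^sup>2"
proof (cases "\<exists>j\<in>A. s < r j")
  case False
  hence "(\<Sum>j\<in>A. (max 0 (r j - s))\<^sup>2) = 0" by (intro sum.neutral) auto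
  thus ?thesis by simp
next
  case True
  then obtain j where j: "j \<in> A" "s < r j" by blast
  define E where "E = (\<Sum>j\<in>A. max 0 (r j - s))"
  have "(\<Sum>j\<in>A. (max 0 (r j - s))\<^sup>2) \<le> (\<Sum>j\<in>A. max 0 (r j - s) * E)"
    unfolding power2_eq_square E_def using assms(1)
    by (intro sum_mono mult_left_mono member_le_sum) auto
  also have "\<dots> = E\<^sup>2" by (simp add: E_def power2_eq_square sum_distrib_right)
  also have "E \<le> sum r A - s"
  proof -
    have "E = (r j - s) + (\<Sum>l\<in>A - {j}. max 0 (r l - s))"
      unfolding E_def using assms(1) j by (subst sum.remove[OF _ j(1)]) auto
    also have "(\<Sum>l\<in>A - {j}. max 0 (r l - s)) \<le> sum r (A - {j})"
      using assms by (intro sum_mono) auto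
    finally show ?thesis using assms(1) j by (simp add: sum.remove)
  qed
  hence "E\<^sup>2 \<le> (sum r A - s)\<^sup>2" by (intro power_mono) (auto simp: E_def intro: sum_nonneg)
  finally show ?thesis .
qed

text \<open>Expand T^2 = 2 s T - s^2 + (T - s)^2 for each configuration, bound the last square from
  below by the individual excesses, and average.\<close>

lemma F_val_ge:
  assumes P: "finite P" "\<And>j. j \<in> P \<Longrightarrow> 0 \<le> norm_size p z P j"
    and \<F>: "finite \<F>" "\<And>f. f \<in> \<F> \<Longrightarrow> 0 \<le> x f" "sum x \<F> = 1"
    and z: "\<And>j. j \<in> P \<Longrightarrow> z j = (\<Sum>f\<in>{f \<in> \<F>. j \<in> f}. x f)" and s: "0 \<le> s"
  shows "2 * s * (\<Sum>j\<in>P. z j * norm_size p z P j) - s\<^sup>2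
    + (\<Sum>j\<in>P. z j * (max 0 (norm_size p z P j - s))\<^sup>2) \<le> F_val p z \<F> x P"
proof -
  \<comment> \<open>Averaging an additive job statistic over configurations depends on
    \<open>x\<close> only through the marginals \<open>z\<close>.\<close>
  have swap: "(\<Sum>j\<in>P. z j * \<phi> j) = (\<Sum>f\<in>\<F>. x f * (\<Sum>j\<in>f \<inter> P. \<phi> j))" for \<phi>
  proof -
    have "(\<Sum>j\<in>P. z j * \<phi> j) = (\<Sum>j\<in>P. \<Sum>f\<in>\<F>. if j \<in> f then x f * \<phi> j else 0)"
      using \<F>(1) by (intro sum.cong refl) (simp add: z sum_distrib_right sum.inter_filter if_distrib[of "\<lambda>t. t * _"] cong: if_cong)
    also have "\<dots> = (\<Sum>f\<in>\<F>. \<Sum>j\<in>P. if j \<in> f then x f * \<phi> j else 0)" by (rule sum.swap)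
    also have "\<dots> = (\<Sum>f\<in>\<F>. x f * (\<Sum>j\<in>f \<inter> P. \<phi> j))"
      using P(1) by (intro sum.cong refl) (auto simp: sum_distrib_left Int_commute[of _ P] sum.inter_restrict intro!: sum.cong)
    finally show ?thesis .
  qed
  have "2 * s * (\<Sum>j\<in>P. z j * norm_size p z P j) - s\<^sup>2 * sum x \<F>
      + (\<Sum>j\<in>P. z j * (max 0 (norm_size p z P j - s))\<^sup>2)
    = (\<Sum>f\<in>\<F>. x f * (2 * s * T_val p z P f - s\<^sup>2 + (\<Sum>j\<in>f \<inter> P. (max 0 (norm_size p z P j - s))\<^sup>2)))"
    unfolding swap T_val_def
    by (simp add: algebra_simps sum.distrib sum_subtractf sum_distrib_left sum_distrib_right)
  also have "\<dots> \<le> (\<Sum>f\<in>\<F>. x f * (T_val p z P f)\<^sup>2)"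
  proof (intro sum_mono mult_left_mono \<F>(2))
    fix f
    have "(\<Sum>j\<in>f \<inter> P. (max 0 (norm_size p z P j - s))\<^sup>2) \<le> (T_val p z P f - s)\<^sup>2"
      unfolding T_val_def using P s by (intro sum_excess_squares_le) auto
    thus "2 * s * T_val p z P f - s\<^sup>2 + (\<Sum>j\<in>f \<inter> P. (max 0 (norm_size p z P j - s))\<^sup>2) \<le> (T_val p z P f)\<^sup>2"
      by (simp add: power2_diff algebra_simps)
  qed
  finally show ?thesis using \<F>(3) by (simp add: F_val_def)
qed

section \<open>Summing the pointwise inequality over the jobs of the prefix\<close>

theorem theorem3p5:
  fixes J :: "'j set" and M :: "'m set"
    and p :: "'j \<Rightarrow> real" and w :: "'m \<Rightarrow> 'j \<Rightarrow> ereal"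
    and y :: "'m \<Rightarrow> 'j set \<Rightarrow> real"
    and i :: 'm and \<sigma> :: "nat \<Rightarrow> 'j" and jstar :: nat
    and z :: "'j \<Rightarrow> real" and P :: "'j set" and \<rho> \<alpha> :: real
  assumes "sched_instance J M p w"
    and "config_lp_feasible J M w y"
    and "i \<in> M"
    and "smith_order J p w i \<sigma>"
    and "1 \<le> jstar" and "jstar \<le> card J"
    and "z = assigned_frac J w y i"
    and "P = \<sigma> ` {1..jstar}"
    and "0 < prefix_volume p z P"
    and "\<rho> = 53 / 25" and "\<alpha> = 823 / 625"
  shows "2 * Q_val p z P + 1 - expected_saving p z P \<rho>
           \<le> \<alpha> * (Q_val p z P + F_val p z (configs J w i) (y i) P)"
proof -
  define r where "r = norm_size p z P"
  define L where "L = ln \<rho>"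
  have finJ: "finite J" and pJ: "\<And>j. j \<in> J \<Longrightarrow> 0 < p j" using assms(1) by (auto simp: sched_instance_def)
  have PJ: "P \<subseteq> J"
  proof -
    have "\<sigma> ` {1..card J} = J" using assms(4) by (simp add: smith_order_def bij_betw_def)
    moreover have "{1..jstar} \<subseteq> {1..card J}" using assms(6) by simp
    ultimately show ?thesis unfolding assms(8) by blast
  qed
  have fin: "finite P" "finite (configs J w i)"
    using finJ PJ by (auto simp: configs_def feasible_jobs_def intro: finite_subset)
  have y: "0 \<le> y i f" if "f \<in> configs J w i" for f
    using assms(2,3) that by (simp add: config_lp_feasible_def)
  have y1: "sum (y i) (configs J w i) = 1" using assms(2,3) by (simp add: config_lp_feasible_def)
  have z_eq: "z j = (\<Sum>f\<in>{f \<in> configs J w i. j \<in> f}. y i f)" for j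
  proof (cases "j \<in> feasible_jobs J w i")
    case False
    hence "{f \<in> configs J w i. j \<in> f} = {}" by (auto simp: configs_def)
    thus ?thesis using False unfolding assms(7) assigned_frac_def by (simp only: if_False sum.empty)
  qed (simp add: assms(7) assigned_frac_def)
  have z0: "0 \<le> z j" for j unfolding z_eq by (intro sum_nonneg) (auto intro: y)
  have p0: "\<And>j. j \<in> P \<Longrightarrow> 0 < p j" using pJ PJ by blast
  have \<rho>: "1 < \<rho>" using assms(10) by simp
  have L: "3/4 \<le> L" "L \<le> 753/1000" using ln_ratio_bounds by (simp_all add: L_def assms(10))
  have r0: "0 < r j" if "j \<in> P" for j
    unfolding r_def by (rule norm_size_pos[OF fin(1) p0 z0 assms(9) \<rho> that])
  have vol: "(\<Sum>j\<in>P. z j * r j) = 1"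
    unfolding r_def by (rule sum_norm_size[OF fin(1) p0 z0 assms(9) \<rho>])
  define D where "D = (\<Sum>m<9. (grid_weight m)\<^sup>2 * ((grid (Suc m))\<^sup>2 - (grid m)\<^sup>2) / 2)"
  define H where "H j = (\<Sum>m<9. 2 * grid_weight m * overlap \<rho> (grid m) (grid (Suc m)) (r j))" for j
  define X where "X = (\<Sum>j\<in>P. z j * (max 0 (r j - 9/10))\<^sup>2)"
  define c where "c = 2 * (9/10) - (9/10 :: real)\<^sup>2"
  have saving: "(\<Sum>j\<in>P. z j * r j * H j) - D \<le> L * expected_saving p z P \<rho>"
    unfolding r_def H_def D_def L_def
  proof (rule expected_saving_ge[where u = "\<lambda>x. \<Sum>m<9. grid_weight m * indicator {grid m..<grid (Suc m)} x"])
    fix x :: real assume "0 < x"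
    from step_cap[OF this] show "\<exists>K::int set. finite K \<and>
        2 * ((\<Sum>m<9. grid_weight m * indicator {grid m..<grid (Suc m)} x) * x) - x\<^sup>2 \<le> (\<Sum>l\<in>K.
        ((\<Sum>m<9. grid_weight m * indicator {grid m..<grid (Suc m)} (x * \<rho> powi l)) * (x * \<rho> powi l))\<^sup>2 -
        (max 0 ((\<Sum>m<9. grid_weight m * indicator {grid m..<grid (Suc m)} (x * \<rho> powi l)) * (x * \<rho> powi l)
          - (\<Sum>m<9. grid_weight m * indicator {grid m..<grid (Suc m)} x) * x))\<^sup>2)"
      unfolding assms(10) .
  qed (use fin p0 z0 assms(9) \<rho> in \<open>auto intro: grid_pos less_imp_le[OF grid_less_Suc] grid_weight_nonneg\<close>)
  have F: "c + X \<le> F_val p z (configs J w i) (y i) P"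
    using F_val_ge[of P p z "configs J w i" "y i" "9/10"] fin y y1 z_eq r0 vol
    unfolding r_def[symmetric] X_def c_def by (simp add: less_imp_le)
  \<comment> \<open>The weights \<open>z j * r j\<close> have sum 1, reproduce Q from the term
    linear in \<open>r j\<close>, and cancel the denominator \<open>r j\<close> of the excess
    term.\<close>
  have "0 \<le> (\<Sum>j\<in>P. z j * r j * (H j - D + L * (\<alpha> * ((max 0 (r j - 9/10))\<^sup>2 / r j + c) - (2 - \<alpha>) * r j - 1)))"
    unfolding H_def D_def c_def assms(10,11)
    by (intro sum_nonneg mult_nonneg_nonneg z0 less_imp_le[OF r0] dual_pointwise r0 L)
  also have "\<dots> = (\<Sum>j\<in>P. z j * r j * H j - D * (z j * r j)
      + L * (\<alpha> * (z j * (max 0 (r j - 9/10))\<^sup>2 + c * (z j * r j)) - (2 - \<alpha>) * (z j * (r j)\<^sup>2) - z j * r j))"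
    using r0 by (intro sum.cong refl) (simp add: field_simps power2_eq_square)
  also have "\<dots> = (\<Sum>j\<in>P. z j * r j * H j) - D * (\<Sum>j\<in>P. z j * r j)
      + L * (\<alpha> * (X + c * (\<Sum>j\<in>P. z j * r j)) - (2 - \<alpha>) * Q_val p z P - (\<Sum>j\<in>P. z j * r j))"
    unfolding X_def Q_val_def r_def by (simp add: sum.distrib sum_subtractf sum_distrib_left right_diff_distrib distrib_left)
  finally have "0 \<le> L * expected_saving p z P \<rho> + L * (\<alpha> * (X + c) - (2 - \<alpha>) * Q_val p z P - 1)"
    using saving vol by simp
  hence "0 \<le> L * (expected_saving p z P \<rho> + \<alpha> * (X + c) - (2 - \<alpha>) * Q_val p z P - 1)"
    by (simp add: algebra_simps)
  hence "0 \<le> expected_saving p z P \<rho> + \<alpha> * (X + c) - (2 - \<alpha>) * Q_val p z P - 1"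
    using L by (simp add: zero_le_mult_iff)
  moreover have "\<alpha> * (X + c) \<le> \<alpha> * F_val p z (configs J w i) (y i) P"
    using F assms(11) by simp
  ultimately show ?thesis by (simp add: algebra_simps)
qed

end
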